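(* The exterior algebra $\Omega^\cdot$ of the Planck scale Hopf algebra $P=\mathbb{C}[x]\blacktriangleright\!\!\triangleleft_{\hbar,\mathsf{G}}\mathbb{C}[p]$ corresponding via twisting to the classical one of $C(B_+)$ has the following properties. The first order calculus has a basis $\{\xi,\eta\}$ of right-invariant 1-forms with $$\mathrm dg=g\xi,\qquad\mathrm dp=g\eta,\qquad[a,\xi]=0,\qquad[a,\eta]=\imath A\,\mathrm da,\qquad\forall a\in P,$$ $$\beta_L(\xi)=1\otimes\xi,\qquad\beta_L(\eta)=g^{-1}\otimes\eta+g^{-1}p\otimes\xi.$$ The 2-forms have relations $$\xi\wedge\xi=0,\qquad\eta\wedge\xi=-\xi\wedge\eta,\qquad\eta\wedge\eta=\imath A\,\xi\wedge\eta,\qquad\mathrm d\xi=0,\qquad\mathrm d\eta=\eta\wedge\xi.$$ As a $\mathbb Z_2$-graded Hopf algebra $\Omega^\cdot$ has the structure $$\Delta\xi=\xi\otimes1+1\otimes\xi,\qquad\Delta\eta=g^{-1}\otimes\eta+g^{-1}p\otimes\xi+\eta\otimes1,$$ $$\epsilon(\xi)=\epsilon(\eta)=0,\qquad S\xi=-\xi,\qquad S\eta=-g\eta+p\xi.$$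
   Context: $\hbar,\mathsf G$ are constants ($\mathsf G\ne0$), $A=\hbar/\mathsf G$, $\imath$ is the imaginary unit. $C(B_+)=\mathbb C[p,g,g^{-1}]$ is the commutative Hopf algebra with $\Delta p=p\otimes g+1\otimes p$, $\Delta g=g\otimes g$, $\epsilon(p)=0$, $\epsilon(g)=1$, $Sp=-pg^{-1}$, $Sg=g^{-1}$. The Planck scale Hopf algebra $P$ (in algebraic form, $g=e^{-x/\mathsf G}$) is generated by $p,g,g^{-1}$ with $[p,g]=\imath A(1-g)g$ and the same formulae for $\Delta,\epsilon,S$ on generators. It equals the cocycle twist $C(B_+)^\chi$ with product $a\bullet b=\chi(a_{(1)}\otimes b_{(1)})a_{(2)}b_{(2)}\chi^{-1}(a_{(3)}\otimes b_{(3)})$ for the unital 2-cocycle with $\chi(p^ng^r\otimes p^mg^s)=\delta_{m,0}(\imath A)^n\prod_{k=0}^{n-1}(-s-k)$ and convolution inverse $\chi^{-1}(p^ng^r\otimes p^mg^s)=\delta_{m,0}(\imath A)^n\prod_{k=0}^{n-1}(s-k)$. The classical exterior algebra of $C(B_+)$ is the usual commutative algebra of (algebraic) differential forms on the 2-dimensional group $B_+$, a super-Hopf algebra with $\mathrm d$ commuting with the coproduct; in degree 1 its coproduct is $\beta_L+\beta_R$, the sum of left and right coactions. Its twist is the same graded space, coproduct, coactions and $\mathrm d$ with the product replaced by $\alpha\bullet\beta=\chi(\alpha_{(1)}\otimes\beta_{(1)})\alpha_{(\underline2)}\beta_{(\underline2)}\chi^{-1}(\alpha_{(3)}\otimes\beta_{(3)})$,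 where the outer legs in $C(B_+)$ are given by the left and right coactions. In the claim all products, including $\wedge$, are those of the twisted algebra; $[a,\omega]=a\omega-\omega a$; right-invariant means $\beta_R(\omega)=\omega\otimes1$. *)

theory Defs
  imports Complex_Main "HOL-Library.Poly_Mapping"
begin

section \<open>Free complex vector spaces and their tensor products\<close>

text \<open>
  The complex vector space with basis \<^typ>\<open>'b\<close> is \<open>'b \<Rightarrow>\<^sub>0 complex\<close>, and the tensor product
  of the spaces with bases \<open>'b\<close> and \<open>'c\<close> is the space with basis \<open>'b \<times> 'c\<close>.
\<close>

type_synonym 'b cvec = "'b \<Rightarrow>\<^sub>0 complex"

definition scale :: "complex \<Rightarrow> 'b cvec \<Rightarrow> 'b cvec" where
  "scale c v = Poly_Mapping.map (\<lambda>x. c * x) v"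

lemma lookup_scale [simp]: "Poly_Mapping.lookup (scale c v) b = c * Poly_Mapping.lookup v b"
  by (simp add: scale_def map.rep_eq when_def)

interpretation cvec: vector_space "scale :: complex \<Rightarrow> 'b cvec \<Rightarrow> 'b cvec"
  by standard (auto intro!: poly_mapping_eqI simp: lookup_add algebra_simps)

abbreviation basis_vec :: "'b \<Rightarrow> 'b cvec" where
  "basis_vec b \<equiv> Poly_Mapping.single b 1"

text \<open>Linear and bilinear extensions of maps given on basis elements.\<close>

definition lin :: "('b \<Rightarrow> 'c cvec) \<Rightarrow> 'b cvec \<Rightarrow> 'c cvec" where
  "lin f v = (\<Sum>b\<in>Poly_Mapping.keys v. scale (Poly_Mapping.lookup v b) (f b))"

lemma lin_superset:
  assumes "finite X" "Poly_Mapping.keys v \<subseteq> X"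
  shows "lin f v = (\<Sum>b\<in>X. scale (Poly_Mapping.lookup v b) (f b))"
  unfolding lin_def using assms by (intro sum.mono_neutral_left) (auto simp: in_keys_iff)

lemma lin_single [simp]: "lin f (Poly_Mapping.single b c) = scale c (f b)"
  by (simp add: lin_def)

lemma lin_zero [simp]: "lin f 0 = 0"
  by (simp add: lin_def)

lemma lin_add [simp]: "lin f (u + v) = lin f u + lin f v"
proof -
  let ?X = "Poly_Mapping.keys u \<union> Poly_Mapping.keys v"
  have "Poly_Mapping.keys (u + v) \<subseteq> ?X" by (rule Poly_Mapping.keys_add)
  then show ?thesis
    by (simp add: lin_superset[of ?X] lookup_add cvec.scale_left_distrib sum.distrib)
qed

lemma lin_scale [simp]: "lin f (scale c v) = scale c (lin f v)"
proof -
  have "Poly_Mapping.keys (scale c v) \<subseteq> Poly_Mapping.keys v" by (auto simp: in_keys_iff)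
  then show ?thesis
    by (simp add: lin_superset[of "Poly_Mapping.keys v"] cvec.scale_sum_right)
qed

lemma lin_uminus [simp]: "lin f (- v) = - lin f v"
  using lin_add[of f v "- v"] by (simp del: lin_add add: eq_neg_iff_add_eq_0 add.commute)

lemma lin_diff [simp]: "lin f (u - v) = lin f u - lin f v"
  using lin_add[of f u "- v"] by (simp del: lin_add)

definition lin_functional :: "('b \<Rightarrow> complex) \<Rightarrow> 'b cvec \<Rightarrow> complex" where
  "lin_functional f v = (\<Sum>b\<in>Poly_Mapping.keys v. Poly_Mapping.lookup v b * f b)"

definition bilin :: "('b \<Rightarrow> 'c \<Rightarrow> 'e cvec) \<Rightarrow> 'b cvec \<Rightarrow> 'c cvec \<Rightarrow> 'e cvec" where
  "bilin f u v = lin (\<lambda>b. lin (f b) v) u"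

definition tensor :: "'b cvec \<Rightarrow> 'c cvec \<Rightarrow> ('b \<times> 'c) cvec" (infixr "\<otimes>" 67) where
  "u \<otimes> v = bilin (\<lambda>b c. basis_vec (b, c)) u v"

definition tensor_map ::
  "('b cvec \<Rightarrow> 'c cvec) \<Rightarrow> ('d cvec \<Rightarrow> 'e cvec) \<Rightarrow> ('b \<times> 'd) cvec \<Rightarrow> ('c \<times> 'e) cvec" where
  "tensor_map f h = lin (\<lambda>(b, c). f (basis_vec b) \<otimes> h (basis_vec c))"

definition tensor_assoc :: "(('b \<times> 'c) \<times> 'd) cvec \<Rightarrow> ('b \<times> 'c \<times> 'd) cvec" where
  "tensor_assoc = lin (\<lambda>((b, c), d). basis_vec (b, c, d))"

definition homogeneous :: "('b \<Rightarrow> nat) \<Rightarrow> nat \<Rightarrow> 'b cvec set" where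
  "homogeneous dg k = {v. \<forall>b\<in>Poly_Mapping.keys v. dg b = k}"

text \<open>The product \<open>(a \<otimes> b)(c \<otimes> d) = (-1)\<^bsup>|b||c|\<^esup> ac \<otimes> bd\<close> of the super tensor square.\<close>

definition super_tensor_mult ::
  "('b \<Rightarrow> nat) \<Rightarrow> ('b cvec \<Rightarrow> 'b cvec \<Rightarrow> 'b cvec) \<Rightarrow>
   ('b \<times> 'b) cvec \<Rightarrow> ('b \<times> 'b) cvec \<Rightarrow> ('b \<times> 'b) cvec" where
  "super_tensor_mult dg mul = bilin (\<lambda>(a, b) (c, d).
     scale ((-1) ^ (dg b * dg c))
       (mul (basis_vec a) (basis_vec c) \<otimes> mul (basis_vec b) (basis_vec d)))"

text \<open>The differential \<open>d \<otimes> id + (-1)\<^bsup>| |\<^esup> id \<otimes> d\<close> of the super tensor square.\<close>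

definition super_tensor_diff ::
  "('b \<Rightarrow> nat) \<Rightarrow> ('b cvec \<Rightarrow> 'b cvec) \<Rightarrow> ('b \<times> 'b) cvec \<Rightarrow> ('b \<times> 'b) cvec" where
  "super_tensor_diff dg D = lin (\<lambda>(a, b).
     D (basis_vec a) \<otimes> basis_vec b + scale ((-1) ^ dg a) (basis_vec a \<otimes> D (basis_vec b)))"


section \<open>Exterior algebras and super-Hopf algebras\<close>

locale graded_algebra =
  fixes dg :: "'b \<Rightarrow> nat"
    and mul :: "'b cvec \<Rightarrow> 'b cvec \<Rightarrow> 'b cvec"
    and unit :: "'b cvec"
  assumes mul_linear_left: "Vector_Spaces.linear scale scale (\<lambda>a. mul a b)"
    and mul_linear_right: "Vector_Spaces.linear scale scale (\<lambda>b. mul a b)"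
    and mul_assoc: "mul (mul a b) c = mul a (mul b c)"
    and mul_unit_left: "mul unit a = a"
    and mul_unit_right: "mul a unit = a"
    and unit_degree: "unit \<in> homogeneous dg 0"
    and mul_degree: "a \<in> homogeneous dg k \<Longrightarrow> b \<in> homogeneous dg l \<Longrightarrow>
      mul a b \<in> homogeneous dg (k + l)"

text \<open>A differential graded algebra generated by its degree 0 part and the differentials of it.\<close>

locale exterior_algebra = graded_algebra dg mul unit
  for dg :: "'b \<Rightarrow> nat" and mul unit +
  fixes diff :: "'b cvec \<Rightarrow> 'b cvec"
  assumes diff_linear: "Vector_Spaces.linear scale scale diff"
    and diff_degree: "a \<in> homogeneous dg k \<Longrightarrow> diff a \<in> homogeneous dg (Suc k)"
    and diff_diff: "diff (diff a) = 0"
    and diff_Leibniz: "a \<in> homogeneous dg k \<Longrightarrow>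
      diff (mul a b) = mul (diff a) b + scale ((-1) ^ k) (mul a (diff b))"
    and generated: "cvec.subspace V \<Longrightarrow> homogeneous dg 0 \<subseteq> V \<Longrightarrow>
      diff ` homogeneous dg 0 \<subseteq> V \<Longrightarrow> (\<And>a b. a \<in> V \<Longrightarrow> b \<in> V \<Longrightarrow> mul a b \<in> V) \<Longrightarrow> V = UNIV"

text \<open>
  The signs depend on degrees mod 2 only and all structure maps preserve the degree, so with
  degrees reduced mod 2 this is a \<open>\<int>\<^sub>2\<close>-graded Hopf algebra.
\<close>

locale super_hopf_algebra = graded_algebra dg mul unit
  for dg :: "'b \<Rightarrow> nat" and mul unit +
  fixes cop :: "'b cvec \<Rightarrow> ('b \<times> 'b) cvec"
    and counit :: "'b cvec \<Rightarrow> complex"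
    and antip :: "'b cvec \<Rightarrow> 'b cvec"
  assumes cop_linear: "Vector_Spaces.linear scale scale cop"
    and counit_linear: "Vector_Spaces.linear scale (*) counit"
    and antip_linear: "Vector_Spaces.linear scale scale antip"
    and cop_degree: "a \<in> homogeneous dg k \<Longrightarrow>
      cop a \<in> homogeneous (\<lambda>(b, c). dg b + dg c) k"
    and counit_degree: "a \<in> homogeneous dg (Suc k) \<Longrightarrow> counit a = 0"
    and antip_degree: "a \<in> homogeneous dg k \<Longrightarrow> antip a \<in> homogeneous dg k"
    and coassoc: "tensor_assoc (tensor_map cop id (cop a)) = tensor_map id cop (cop a)"
    and counit_left: "lin (\<lambda>(b, c). scale (counit (basis_vec b)) (basis_vec c)) (cop a) = a"
    and counit_right: "lin (\<lambda>(b, c). scale (counit (basis_vec c)) (basis_vec b)) (cop a) = a"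
    and cop_mul: "cop (mul a b) = super_tensor_mult dg mul (cop a) (cop b)"
    and cop_unit: "cop unit = unit \<otimes> unit"
    and counit_mul: "counit (mul a b) = counit a * counit b"
    and counit_unit: "counit unit = 1"
    and antip_left: "lin (\<lambda>(b, c). mul (antip (basis_vec b)) (basis_vec c)) (cop a)
      = scale (counit a) unit"
    and antip_right: "lin (\<lambda>(b, c). mul (basis_vec b) (antip (basis_vec c))) (cop a)
      = scale (counit a) unit"


section \<open>The classical exterior algebra of \<open>C(B\<^sub>+) = \<complex>[p, g, g\<^sup>-\<^sup>1]\<close>\<close>

text \<open>
  The index \<open>(n, r, i, j)\<close> stands for the form \<open>p\<^sup>n g\<^sup>r (dp)\<^sup>i \<and> (dg)\<^sup>j\<close>, with \<open>i\<close> and \<open>j\<close>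
  saying whether \<open>dp\<close> and \<open>dg\<close> are present. Degree 0 is \<open>C(B\<^sub>+)\<close>.
\<close>

type_synonym mono = "nat \<times> int \<times> bool \<times> bool"
type_synonym form = "mono cvec"

abbreviation mono_form :: "nat \<Rightarrow> int \<Rightarrow> bool \<Rightarrow> bool \<Rightarrow> form" where
  "mono_form n r i j \<equiv> basis_vec (n, r, i, j)"

definition form_degree :: "mono \<Rightarrow> nat" where
  "form_degree = (\<lambda>(n, r, i, j). of_bool i + of_bool j)"

abbreviation forms :: "nat \<Rightarrow> form set" where
  "forms k \<equiv> homogeneous form_degree k"

definition one_form :: form where "one_form = mono_form 0 0 False False"
definition gen_p :: form where "gen_p = mono_form 1 0 False False"
definition gen_g :: form where "gen_g = mono_form 0 1 False False"
definition gen_ginv :: form where "gen_ginv = mono_form 0 (-1) False False"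

definition classical_wedge :: "form \<Rightarrow> form \<Rightarrow> form" where
  "classical_wedge = bilin (\<lambda>(n, r, i, j) (m, s, k, l).
     if i \<and> k \<or> j \<and> l then 0
     else scale (if j \<and> k then -1 else 1) (mono_form (n + m) (r + s) (i \<or> k) (j \<or> l)))"

definition ext_d :: "form \<Rightarrow> form" where
  "ext_d = lin (\<lambda>(n, r, i, j). classical_wedge
     (scale (of_nat n) (mono_form (n - 1) r True False)
      + scale (of_int r) (mono_form n (r - 1) False True))
     (mono_form 0 0 i j))"

text \<open>
  The coproduct is the super-algebra map with \<open>\<Delta> p = p \<otimes> g + 1 \<otimes> p\<close> and
  \<open>\<Delta> g\<^sup>r = g\<^sup>r \<otimes> g\<^sup>r\<close> that commutes with the differentials; its values on \<open>dp\<close> and \<open>dg\<close>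
  are therefore the differentials of \<open>\<Delta> p\<close> and \<open>\<Delta> g\<close>.
\<close>

definition cop_p :: "(mono \<times> mono) cvec" where
  "cop_p = gen_p \<otimes> gen_g + one_form \<otimes> gen_p"

definition cop_g_pow :: "int \<Rightarrow> (mono \<times> mono) cvec" where
  "cop_g_pow r = mono_form 0 r False False \<otimes> mono_form 0 r False False"

definition form_cop :: "form \<Rightarrow> (mono \<times> mono) cvec" where
  "form_cop =
    (let m = super_tensor_mult form_degree classical_wedge;
         D = super_tensor_diff form_degree ext_d
     in lin (\<lambda>(n, r, i, j).
       m (m (m ((m cop_p ^^ n) (one_form \<otimes> one_form)) (cop_g_pow r))
            (if i then D cop_p else one_form \<otimes> one_form))
         (if j then D (cop_g_pow 1) else one_form \<otimes> one_form)))"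

definition form_counit :: "form \<Rightarrow> complex" where
  "form_counit = lin_functional (\<lambda>(n, r, i, j). if n = 0 \<and> \<not> i \<and> \<not> j then 1 else 0)"

text \<open>
  The coactions of \<open>C(B\<^sub>+)\<close> are the components of the coproduct with one leg in degree 0
  (in degree 1, the coproduct is their sum); \<open>C(B\<^sub>+)\<close> is kept as the degree 0 part of the forms.
\<close>

definition degree0_part :: "form \<Rightarrow> form" where
  "degree0_part = lin (\<lambda>b. if form_degree b = 0 then basis_vec b else 0)"

definition coact_left :: "form \<Rightarrow> (mono \<times> mono) cvec" where
  "coact_left \<omega> = tensor_map degree0_part id (form_cop \<omega>)"

definition coact_right :: "form \<Rightarrow> (mono \<times> mono) cvec" where
  "coact_right \<omega> = tensor_map id degree0_part (form_cop \<omega>)"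

definition bicoaction :: "form \<Rightarrow> (mono \<times> mono \<times> mono) cvec" where
  "bicoaction \<omega> = tensor_assoc (tensor_map coact_left id (coact_right \<omega>))"


section \<open>The twist\<close>

text \<open>
  The cocycle and its convolution inverse on basis elements of \<open>C(B\<^sub>+)\<close>. They are only ever
  evaluated on degree 0 legs; the value 0 in positive degree is a convention.
\<close>

definition cocycle :: "complex \<Rightarrow> mono \<Rightarrow> mono \<Rightarrow> complex" where
  "cocycle A = (\<lambda>(n, r, i, j) (m, s, k, l).
     if m = 0 \<and> \<not> i \<and> \<not> j \<and> \<not> k \<and> \<not> l
     then (\<i> * A) ^ n * (\<Prod>q<n. - of_int s - of_nat q) else 0)"

definition cocycle_inv :: "complex \<Rightarrow> mono \<Rightarrow> mono \<Rightarrow> complex" where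
  "cocycle_inv A = (\<lambda>(n, r, i, j) (m, s, k, l).
     if m = 0 \<and> \<not> i \<and> \<not> j \<and> \<not> k \<and> \<not> l
     then (\<i> * A) ^ n * (\<Prod>q<n. of_int s - of_nat q) else 0)"

text \<open>
  The outer legs have degree 0, so no signs appear. On \<^term>\<open>forms 0\<close> this is the product of
  the Planck scale Hopf algebra \<open>P\<close>; on all forms it is that of its exterior algebra, the
  differential, coproduct, counit and coactions being the classical ones.
\<close>

definition twisted_mult :: "complex \<Rightarrow> form \<Rightarrow> form \<Rightarrow> form" where
  "twisted_mult A \<alpha> \<beta> = bilin (\<lambda>(a1, a2, a3) (b1, b2, b3).
     scale (cocycle A a1 b1 * cocycle_inv A a3 b3)
       (classical_wedge (basis_vec a2) (basis_vec b2)))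
     (bicoaction \<alpha>) (bicoaction \<beta>)"

abbreviation twisted_mult_infix :: "form \<Rightarrow> complex \<Rightarrow> form \<Rightarrow> form"
  ("(_ \<bullet>\<^bsub>_\<^esub>/ _)" [71, 0, 72] 71) where
  "\<alpha> \<bullet>\<^bsub>A\<^esub> \<beta> \<equiv> twisted_mult A \<alpha> \<beta>"

text \<open>The defining relation \<open>[p, g] = \<i>A(1 - g)g\<close> of \<open>P\<close> holds for the twisted product.\<close>

lemma planck_relation:
  "gen_p \<bullet>\<^bsub>A\<^esub> gen_g - gen_g \<bullet>\<^bsub>A\<^esub> gen_p
    = scale (\<i> * A) ((one_form - gen_g) \<bullet>\<^bsub>A\<^esub> gen_g)"
proof -
  have mult: "super_tensor_mult form_degree classical_wedge (basis_vec (a, b)) (basis_vec (c, d))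
    = scale ((-1) ^ (form_degree b * form_degree c))
       (classical_wedge (basis_vec a) (basis_vec c) \<otimes> classical_wedge (basis_vec b) (basis_vec d))"
    for a b c d by (simp add: super_tensor_mult_def bilin_def)
  have dist: "super_tensor_mult form_degree classical_wedge (u + v) w
    = super_tensor_mult form_degree classical_wedge u w
      + super_tensor_mult form_degree classical_wedge v w" for u v w
    by (simp add: super_tensor_mult_def bilin_def)
  have wedge: "classical_wedge (mono_form n r False False) (mono_form m s False False)
    = mono_form (n + m) (r + s) False False" for n r m s
    by (simp add: classical_wedge_def bilin_def)
  have tens: "basis_vec b \<otimes> basis_vec c = basis_vec (b, c)" for b :: mono and c :: mono
    by (simp add: tensor_def bilin_def)
  have tens3: "basis_vec b \<otimes> basis_vec c = basis_vec (b, c)" for b :: "mono \<times> mono" and c :: mono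
    by (simp add: tensor_def bilin_def)
  have deg: "form_degree (n, r, i, j) = of_bool i + of_bool j" for n r i j
    by (simp add: form_degree_def)
  have cp: "form_cop gen_p = cop_p"
    by (simp add: form_cop_def gen_p_def gen_g_def one_form_def cop_p_def cop_g_pow_def tens mult dist wedge
      deg Let_def)
  have cg: "form_cop (mono_form 0 r False False) = cop_g_pow r" for r
    by (simp add: form_cop_def one_form_def cop_g_pow_def tens mult wedge deg Let_def)
  have c1: "form_cop one_form = one_form \<otimes> one_form"
    using cg[of 0] by (simp add: one_form_def cop_g_pow_def)
  note simps = bicoaction_def coact_left_def coact_right_def tensor_map_def tensor_assoc_def
      degree0_part_def deg tens tens3
  have p: "bicoaction gen_p = basis_vec ((1, 0, False, False), (0, 1, False, False), (0, 1, False, False))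
     + basis_vec ((0, 0, False, False), (1, 0, False, False), (0, 1, False, False))
     + basis_vec ((0, 0, False, False), (0, 0, False, False), (1, 0, False, False))"
    using cp cg[of 0] cg[of 1]
    by (simp add: simps cop_p_def cop_g_pow_def gen_p_def gen_g_def one_form_def tensor_def bilin_def)
  have g: "bicoaction gen_g = basis_vec ((0, 1, False, False), (0, 1, False, False), (0, 1, False, False))"
    using cg[of 1] by (simp add: simps cop_g_pow_def gen_g_def)
  have o: "bicoaction one_form = basis_vec ((0, 0, False, False), (0, 0, False, False), (0, 0, False, False))"
    using cg[of 0] by (simp add: simps cop_g_pow_def one_form_def)
  have og: "bicoaction (one_form - gen_g) = bicoaction one_form - bicoaction gen_g"
    by (simp add: bicoaction_def coact_right_def form_cop_def Let_def tensor_map_def tensor_assoc_def)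
  show ?thesis
    by (simp add: twisted_mult_def p g o og bilin_def cocycle_def cocycle_inv_def
      classical_wedge_def cvec.scale_right_diff_distrib)
qed

definition twisted_commutator :: "complex \<Rightarrow> form \<Rightarrow> form \<Rightarrow> form" where
  "twisted_commutator A a \<omega> = a \<bullet>\<^bsub>A\<^esub> \<omega> - \<omega> \<bullet>\<^bsub>A\<^esub> a"

definition right_invariant :: "form \<Rightarrow> bool" where
  "right_invariant \<omega> \<longleftrightarrow> coact_right \<omega> = \<omega> \<otimes> one_form"

end

theory Submission
  imports Defs
begin

text \<open>
  Put \<open>t = \<i> A\<close>. The twist acts through two commuting even derivations of the classical
  exterior algebra: \<open>E\<^sub>L\<close>, the Lie derivative with \<open>p \<mapsto> g\<close>, \<open>g \<mapsto> 0\<close> (so \<open>dp \<mapsto> dg\<close>), and \<open>E\<^sub>R\<close>, with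
  \<open>p \<mapsto> 1\<close>, \<open>g \<mapsto> 0\<close>. They come from the left and the right coaction paired with the functional that
  picks the coefficient of \<open>p\<close> at \<open>g = 1\<close>. Give \<open>p\<^sup>n g\<^sup>r (dp)\<^sup>i (dg)\<^sup>j\<close> the left weight \<open>l = r + j\<close> and the
  right weight \<open>n + r + i + j\<close>; these record the powers of \<open>g\<close> in the terms of its coactions that
  the counit of \<open>C(B\<^sub>+)\<close> does not kill on the coacting leg. With \<open>X = 1 + t E\<^sub>L\<close> and \<open>Y = 1 + t E\<^sub>R\<close> the
  twisted product with a \<open>\<beta>\<close> of weights \<open>(l, r)\<close> is \<open>\<alpha> \<bullet> \<beta> = (X\<^sup>-\<^sup>l Y\<^sup>r \<alpha>) \<and> \<beta>\<close> (\<open>twisted_mult_basis\<close>).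
  The powers exist because \<open>X\<close> and \<open>Y\<close> are invertible; \<open>X\<^sup>c\<close> and \<open>Y\<^sup>c\<close> pair a leg of the coproduct with
  one and the same functional, \<open>chi\<close>.

  Since \<open>E\<^sub>L\<close> raises the left weight by 1 and \<open>E\<^sub>R\<close> lowers the right weight by 1, \<open>X\<close> and \<open>Y\<close> are
  automorphisms of \<open>\<bullet>\<close> (\<open>step_left_twisted_mult\<close>, \<open>step_right_twisted_mult\<close>). This makes \<open>\<bullet>\<close>
  associative. As \<open>d\<close> commutes with \<open>E\<^sub>L\<close>, \<open>E\<^sub>R\<close> and preserves the weights, it remains a derivation.
  All relations of the theorem follow for \<open>\<xi> = g\<^sup>-\<^sup>1 dg\<close> of weights \<open>(0, 0)\<close> and \<open>\<eta> = g\<^sup>-\<^sup>1 dp\<close> of weights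
  \<open>(-1, 0)\<close>, for which \<open>\<alpha> \<bullet> \<xi> = \<alpha> \<and> \<xi>\<close> and \<open>\<alpha> \<bullet> \<eta> = X \<alpha> \<and> \<eta>\<close>; the right-invariant 1-forms are
  those killed by \<open>E\<^sub>R\<close> and of right weight 0.

  The classical coproduct is multiplicative by a universal property of the exterior algebra, and
  identities such as coassociativity then need checking on generators only. Every term \<open>b \<otimes> c\<close> of
  the coproduct of a monomial \<open>a\<close> is a path: the weights \<open>(l, m)\<close> of \<open>b\<close> and \<open>(m, r)\<close> of \<open>c\<close> compose to
  those of \<open>a\<close> (\<open>keys_form_cop\<close>). In \<open>\<Delta>\<alpha> \<bullet> \<Delta>\<beta>\<close> the operators \<open>Y\<^sup>m\<close> on the first leg of \<open>\<Delta>\<alpha>\<close> and \<open>X\<^sup>-\<^sup>m\<close>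
  on the second cancel, by coassociativity, and the outer ones assemble to \<open>\<Delta>(X\<^sup>-\<^sup>l Y\<^sup>r \<alpha>)\<close>; so \<open>\<Delta>\<close> is
  multiplicative for \<open>\<bullet>\<close> as well.

  For the antipode, \<open>n + 2 i + j\<close> is a grading of the coalgebra whose degree 0 part is spanned by
  the grouplike elements \<open>g\<^sup>r\<close>. Solving \<open>S(\<alpha>\<^sub>1) \<bullet> \<alpha>\<^sub>2 = \<epsilon>(\<alpha>)\<close> recursively along it gives a left
  convolution inverse \<open>S\<close> of the identity. Then \<open>\<epsilon> - id * S\<close> is a convolution idempotent vanishing
  on the \<open>g\<^sup>r\<close>, hence zero, and \<open>S\<close> is a right inverse too.
\<close>

section \<open>Linear maps on free vector spaces\<close>

abbreviation linear_map :: "('b cvec \<Rightarrow> 'c cvec) \<Rightarrow> bool" where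
  "linear_map f \<equiv> Vector_Spaces.linear scale scale f"

lemma linear_mapI:
  assumes "\<And>u v. f (u + v) = f u + f v" and "\<And>c u. f (scale c u) = scale c (f u)"
  shows "linear_map f"
  using assms by unfold_locales

lemma
  assumes "linear_map f"
  shows linear_map_add: "f (u + v) = f u + f v"
    and linear_map_scale: "f (scale c u) = scale c (f u)"
    and linear_map_zero: "f 0 = 0"
    and linear_map_diff: "f (u - v) = f u - f v"
    and linear_map_uminus: "f (- v) = - f v"
    and linear_map_sum: "f (sum h X) = (\<Sum>x\<in>X. f (h x))"
proof -
  interpret Vector_Spaces.linear scale scale f by (rule assms)
  show "f (u + v) = f u + f v" "f (scale c u) = scale c (f u)" "f 0 = 0"
    "f (u - v) = f u - f v" "f (- v) = - f v" "f (sum h X) = (\<Sum>x\<in>X. f (h x))"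
    by (rule add scale zero diff neg sum)+
qed

lemma cvec_expand: "v = (\<Sum>b\<in>Poly_Mapping.keys v. scale (Poly_Mapping.lookup v b) (basis_vec b))"
proof (rule poly_mapping_eqI)
  fix k
  have "(\<Sum>b\<in>Poly_Mapping.keys v. Poly_Mapping.lookup v b * (1 when b = k))
      = (\<Sum>b\<in>Poly_Mapping.keys v. if b = k then Poly_Mapping.lookup v b else 0)"
    by (intro sum.cong) (auto simp: when_def)
  then show "Poly_Mapping.lookup v k = Poly_Mapping.lookup
      (\<Sum>b\<in>Poly_Mapping.keys v. scale (Poly_Mapping.lookup v b) (basis_vec b)) k"
    by (simp add: lookup_sum lookup_single in_keys_iff sum.delta' eq_commute[of k] sum.delta)
qed

lemma supported_induct [consumes 1, case_names zero basis add scale]: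
  assumes "Poly_Mapping.keys v \<subseteq> K" and "P 0" and "\<And>b. b \<in> K \<Longrightarrow> P (basis_vec b)"
    and "\<And>u v. P u \<Longrightarrow> P v \<Longrightarrow> P (u + v)" and "\<And>c u. P u \<Longrightarrow> P (scale c u)"
  shows "P v"
proof -
  have "P (\<Sum>b\<in>X. scale (Poly_Mapping.lookup v b) (basis_vec b))" if "finite X" "X \<subseteq> K" for X
    using that by (induction X) (auto intro: assms)
  from this[of "Poly_Mapping.keys v"] show ?thesis
    using assms(1) cvec_expand[of v] by simp
qed

lemma cvec_induct [case_names basis add scale]:
  assumes "\<And>b. P (basis_vec b)"
    and "\<And>u v. P u \<Longrightarrow> P v \<Longrightarrow> P (u + v)" and "\<And>c u. P u \<Longrightarrow> P (scale c u)"
  shows "P v"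
proof (rule supported_induct[of v UNIV])
  show "P 0"
    using assms(3)[OF assms(1), of 0 undefined] by simp
qed (use assms in auto)

lemma linear_lin: "linear_map (lin f)"
  by (rule linear_mapI) simp_all

lemma linear_map_eq_on:
  assumes "linear_map f" "linear_map h" "\<And>b. b \<in> Poly_Mapping.keys v \<Longrightarrow> f (basis_vec b) = h (basis_vec b)"
  shows "f v = h v"
  using assms(3)
  by (subst (1 2) cvec_expand[of v])
    (simp add: linear_map_sum[OF assms(1)] linear_map_sum[OF assms(2)]
      linear_map_scale[OF assms(1)] linear_map_scale[OF assms(2)])

lemma lin_basis [simp]: "lin basis_vec v = v"
  using cvec_expand[of v] by (simp add: lin_def)

lemma lin_cong_keys:
  assumes "\<And>b. b \<in> Poly_Mapping.keys v \<Longrightarrow> f b = h b"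
  shows "lin f v = lin h v"
  using assms by (simp add: lin_def)

lemma linear_lin_eq: "linear_map h \<Longrightarrow> h (lin f v) = lin (\<lambda>b. h (f b)) v"
  by (simp add: lin_def linear_map_sum linear_map_scale)

lemma lin_lin: "lin f (lin h v) = lin (\<lambda>b. lin f (h b)) v"
  by (rule linear_lin_eq) (rule linear_lin)

lemma lin_plus_fun: "lin (\<lambda>b. f b + h b) v = lin f v + lin h v"
  by (induction v rule: cvec_induct) (simp_all add: cvec.scale_right_distrib)

lemma lin_scale_fun: "lin (\<lambda>b. scale c (f b)) v = scale c (lin f v)"
  by (induction v rule: cvec_induct) (simp_all add: cvec.scale_right_distrib mult.commute)

lemma lin_zero_fun [simp]: "lin (\<lambda>b. 0) v = 0" "lin (\<lambda>(b, c). 0) w = 0"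
  by (simp_all add: lin_def case_prod_unfold)

lemma linear_id: "linear_map (\<lambda>v. v)" "linear_map id"
  by (rule linear_mapI; simp)+

lemma linear_compose: "linear_map f \<Longrightarrow> linear_map h \<Longrightarrow> linear_map (\<lambda>v. f (h v))"
  by (rule linear_mapI) (simp_all add: linear_map_add linear_map_scale)

lemma lin_functional_basis [simp]: "lin_functional f (basis_vec b) = f b"
  by (simp add: lin_functional_def)

lemma lin_functional_superset:
  assumes "finite X" "Poly_Mapping.keys v \<subseteq> X"
  shows "lin_functional f v = (\<Sum>b\<in>X. Poly_Mapping.lookup v b * f b)"
  unfolding lin_functional_def using assms by (intro sum.mono_neutral_left) (auto simp: in_keys_iff)

lemma lin_functional_add [simp]: "lin_functional f (u + v) = lin_functional f u + lin_functional f v"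
proof -
  let ?X = "Poly_Mapping.keys u \<union> Poly_Mapping.keys v"
  have "Poly_Mapping.keys (u + v) \<subseteq> ?X" by (rule Poly_Mapping.keys_add)
  then show ?thesis
    by (simp add: lin_functional_superset[of ?X] lookup_add algebra_simps sum.distrib)
qed

lemma lin_functional_scale [simp]: "lin_functional f (scale c v) = c * lin_functional f v"
proof -
  have "Poly_Mapping.keys (scale c v) \<subseteq> Poly_Mapping.keys v" by (auto simp: in_keys_iff)
  then show ?thesis
    by (simp add: lin_functional_superset[of "Poly_Mapping.keys v"] sum_distrib_left mult.assoc)
qed

subsection \<open>Bilinear maps and tensors\<close>

lemma bilin_basis [simp]: "bilin f (basis_vec b) (basis_vec c) = f b c"
  by (simp add: bilin_def)

lemma bilin_left [simp]:
  "bilin f (u + u') v = bilin f u v + bilin f u' v"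
  "bilin f (scale c u) v = scale c (bilin f u v)"
  "bilin f 0 v = 0" "bilin f (- u) v = - bilin f u v" "bilin f (u - u') v = bilin f u v - bilin f u' v"
  by (simp_all add: bilin_def)

lemma bilin_right [simp]:
  "bilin f u (v + v') = bilin f u v + bilin f u v'"
  "bilin f u (scale c v) = scale c (bilin f u v)"
  "bilin f u 0 = 0" "bilin f u (- v) = - bilin f u v" "bilin f u (v - v') = bilin f u v - bilin f u v'"
proof -
  show "bilin f u (v + v') = bilin f u v + bilin f u v'" for v v'
    by (simp add: bilin_def lin_plus_fun)
  moreover show "bilin f u (scale c v) = scale c (bilin f u v)" for v c
    by (simp add: bilin_def lin_scale_fun)
  ultimately have "linear_map (bilin f u)"
    by (intro linear_mapI)
  then show "bilin f u 0 = 0" "bilin f u (- v) = - bilin f u v"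
    "bilin f u (v - v') = bilin f u v - bilin f u v'"
    by (simp_all add: linear_map_zero linear_map_uminus linear_map_diff)
qed

lemma bilin_lin: "bilin f u v = lin (\<lambda>(b, c). f b c) (u \<otimes> v)"
  unfolding tensor_def bilin_def lin_lin by simp

lemma tensor_basis [simp]: "basis_vec b \<otimes> basis_vec c = basis_vec (b, c)"
  by (simp add: tensor_def)

lemma tensor_left [simp]:
  "(u + u') \<otimes> v = u \<otimes> v + u' \<otimes> v" "scale c u \<otimes> v = scale c (u \<otimes> v)"
  "0 \<otimes> v = 0" "- u \<otimes> v = - (u \<otimes> v)" "(u - u') \<otimes> v = u \<otimes> v - u' \<otimes> v"
  by (simp_all add: tensor_def)

lemma tensor_right [simp]:
  "u \<otimes> (v + v') = u \<otimes> v + u \<otimes> v'" "u \<otimes> scale c v = scale c (u \<otimes> v)"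
  "u \<otimes> 0 = 0" "u \<otimes> - v = - (u \<otimes> v)" "u \<otimes> (v - v') = u \<otimes> v - u \<otimes> v'"
  by (simp_all add: tensor_def)

lemma linear_tensor_left: "linear_map (\<lambda>u. u \<otimes> v)"
  and linear_tensor_right: "linear_map (\<lambda>v. u \<otimes> v)"
  by (rule linear_mapI; simp)+

lemma linear_tensor_map: "linear_map (tensor_map f h)"
  by (simp add: tensor_map_def linear_lin)

lemmas tensor_map_add [simp] = linear_map_add[OF linear_tensor_map]
  and tensor_map_scale [simp] = linear_map_scale[OF linear_tensor_map]
  and tensor_map_zero [simp] = linear_map_zero[OF linear_tensor_map]

lemma tensor_map_basis [simp]: "tensor_map f h (basis_vec (b, c)) = f (basis_vec b) \<otimes> h (basis_vec c)"
  by (simp add: tensor_map_def)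

lemma tensor_map_tensor:
  assumes f: "linear_map f" and h: "linear_map h"
  shows "tensor_map f h (u \<otimes> v) = f u \<otimes> h v"
proof (induction u rule: cvec_induct)
  case (basis b)
  show ?case
    by (induction v rule: cvec_induct) (simp_all add: linear_map_add[OF h] linear_map_scale[OF h])
qed (simp_all add: linear_map_add[OF f] linear_map_scale[OF f])

lemma tensor_map_id [simp]: "tensor_map id id x = x" "tensor_map (\<lambda>v. v) (\<lambda>v. v) x = x"
  by (induction x rule: cvec_induct; simp add: split_paired_all)+

lemma lin_tensor:
  "lin (\<lambda>(b, c). f b c) (u \<otimes> v) = lin (\<lambda>b. lin (\<lambda>c. f b c) v) u"
  by (simp add: bilin_lin[symmetric] bilin_def)

lemma tensor_assoc_tensor [simp]: "tensor_assoc ((u \<otimes> v) \<otimes> w) = u \<otimes> v \<otimes> w"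
proof -
  have [simp]: "tensor_assoc (x + y) = tensor_assoc x + tensor_assoc y"
    "tensor_assoc (scale c x) = scale c (tensor_assoc x)" for x y c
    by (simp_all add: tensor_assoc_def)
  show ?thesis
  proof (induction u rule: cvec_induct)
    case (basis b)
    show ?case
    proof (induction v rule: cvec_induct)
      case (basis c)
      show ?case
        by (induction w rule: cvec_induct) (simp_all add: tensor_assoc_def)
    qed simp_all
  qed simp_all
qed

lemma linear_tensor_assoc: "linear_map tensor_assoc"
  by (simp add: tensor_assoc_def linear_lin)

lemmas tensor_assoc_add [simp] = linear_map_add[OF linear_tensor_assoc]
  and tensor_assoc_scale [simp] = linear_map_scale[OF linear_tensor_assoc]

lemma tensor_assoc_basis [simp]: "tensor_assoc (basis_vec ((a, b), c)) = basis_vec (a, b, c)"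
  by (simp add: tensor_assoc_def)

section \<open>Tensor products of graded algebras\<close>

lemma homogeneous_basis [simp]: "basis_vec b \<in> homogeneous dg k \<longleftrightarrow> dg b = k"
  by (simp add: homogeneous_def)

lemma homogeneous_zero [simp]: "0 \<in> homogeneous dg k"
  by (simp add: homogeneous_def)

lemma homogeneous_add [intro, simp]:
  "u \<in> homogeneous dg k \<Longrightarrow> v \<in> homogeneous dg k \<Longrightarrow> u + v \<in> homogeneous dg k"
  using Poly_Mapping.keys_add[of u v] by (auto simp: homogeneous_def)

lemma homogeneous_scale [intro, simp]: "u \<in> homogeneous dg k \<Longrightarrow> scale c u \<in> homogeneous dg k"
  by (auto simp: homogeneous_def in_keys_iff)

lemma homogeneous_uminus [intro, simp]: "u \<in> homogeneous dg k \<Longrightarrow> - u \<in> homogeneous dg k"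
  by (simp add: homogeneous_def)

lemma homogeneous_sum: "(\<And>x. x \<in> X \<Longrightarrow> f x \<in> homogeneous dg k) \<Longrightarrow> sum f X \<in> homogeneous dg k"
  by (induction X rule: infinite_finite_induct) auto

lemma homogeneous_induct [consumes 1, case_names zero basis add scale]:
  assumes "v \<in> homogeneous dg k" and "P 0" and "\<And>b. dg b = k \<Longrightarrow> P (basis_vec b)"
    and "\<And>u v. P u \<Longrightarrow> P v \<Longrightarrow> P (u + v)" and "\<And>c u. P u \<Longrightarrow> P (scale c u)"
  shows "P v"
  by (rule supported_induct[of v "{b. dg b = k}"]) (use assms in \<open>auto simp: homogeneous_def\<close>)

lemma homogeneous_lin:
  "(\<And>b. b \<in> Poly_Mapping.keys v \<Longrightarrow> f b \<in> homogeneous dg k) \<Longrightarrow> lin f v \<in> homogeneous dg k"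
  by (auto simp: lin_def intro: homogeneous_sum)

lemma homogeneous_tensor:
  assumes "u \<in> homogeneous dg k" "v \<in> homogeneous dg' l"
  shows "u \<otimes> v \<in> homogeneous (\<lambda>(b, c). dg b + dg' c) (k + l)"
  using assms unfolding tensor_def bilin_def
  by (intro homogeneous_lin) (auto simp: homogeneous_def)

context graded_algebra
begin

lemmas mul_left_simps [simp] =
  linear_map_add[OF mul_linear_left] linear_map_scale[OF mul_linear_left]
  linear_map_zero[OF mul_linear_left] linear_map_uminus[OF mul_linear_left]
  linear_map_diff[OF mul_linear_left]

lemmas mul_right_simps [simp] =
  linear_map_add[OF mul_linear_right] linear_map_scale[OF mul_linear_right]
  linear_map_zero[OF mul_linear_right] linear_map_uminus[OF mul_linear_right]
  linear_map_diff[OF mul_linear_right]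

end

text \<open>
  The product of the super tensor product of two graded algebras on possibly different bases.
  Unlike \<^const>\<open>super_tensor_mult\<close> it can be iterated, as coassociativity requires.
\<close>

definition tensor_mult ::
  "('b \<Rightarrow> nat) \<Rightarrow> ('b cvec \<Rightarrow> 'b cvec \<Rightarrow> 'b cvec) \<Rightarrow> ('c \<Rightarrow> nat) \<Rightarrow> ('c cvec \<Rightarrow> 'c cvec \<Rightarrow> 'c cvec) \<Rightarrow>
   ('b \<times> 'c) cvec \<Rightarrow> ('b \<times> 'c) cvec \<Rightarrow> ('b \<times> 'c) cvec" where
  "tensor_mult dg mul dg' mul' = bilin (\<lambda>(a, b) (c, d).
     scale ((-1) ^ (dg' b * dg c))
       (mul (basis_vec a) (basis_vec c) \<otimes> mul' (basis_vec b) (basis_vec d)))"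

lemma super_tensor_mult_eq: "super_tensor_mult dg mul = tensor_mult dg mul dg mul"
  by (simp add: super_tensor_mult_def tensor_mult_def)

lemma tensor_mult_simps [simp]:
  "tensor_mult dg mul dg' mul' (x + x') y = tensor_mult dg mul dg' mul' x y + tensor_mult dg mul dg' mul' x' y"
  "tensor_mult dg mul dg' mul' (scale e x) y = scale e (tensor_mult dg mul dg' mul' x y)"
  "tensor_mult dg mul dg' mul' 0 y = 0"
  "tensor_mult dg mul dg' mul' (- x) y = - tensor_mult dg mul dg' mul' x y"
  "tensor_mult dg mul dg' mul' x (y + y') = tensor_mult dg mul dg' mul' x y + tensor_mult dg mul dg' mul' x y'"
  "tensor_mult dg mul dg' mul' x (scale e y) = scale e (tensor_mult dg mul dg' mul' x y)"
  "tensor_mult dg mul dg' mul' x 0 = 0"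
  "tensor_mult dg mul dg' mul' x (- y) = - tensor_mult dg mul dg' mul' x y"
  by (simp_all add: tensor_mult_def)

lemma tensor_mult_basis:
  "tensor_mult dg mul dg' mul' (basis_vec (a, b)) (basis_vec (c, d)) = scale ((-1) ^ (dg' b * dg c))
       (mul (basis_vec a) (basis_vec c) \<otimes> mul' (basis_vec b) (basis_vec d))"
  by (simp add: tensor_mult_def)

lemma linear_tensor_mult_right: "linear_map (tensor_mult dg mul dg' mul' x)"
  by (rule linear_mapI) simp_all

text \<open>
  Two graded algebras, not assumed to be related.
\<close>

locale graded_algebra_pair =
  A: graded_algebra dg mul unit + B: graded_algebra dg' mul' unit'
  for dg :: "'b \<Rightarrow> nat" and mul unit and dg' :: "'c \<Rightarrow> nat" and mul' unit'
begin

abbreviation tmul where "tmul \<equiv> tensor_mult dg mul dg' mul'"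
abbreviation tdeg where "tdeg \<equiv> (\<lambda>(b, c). dg b + dg' c)"

text \<open>
  The sign of the product, given on basis elements by their degrees, only depends on the degrees of
  the inner factors when these are homogeneous.
\<close>

lemma tmul_tensor:
  assumes "v \<in> homogeneous dg' k" and "w \<in> homogeneous dg l"
  shows "tmul (u \<otimes> v) (w \<otimes> z) = scale ((-1) ^ (k * l)) (mul u w \<otimes> mul' v z)"
  using assms
proof (induction v rule: homogeneous_induct)
  case (basis b)
  from basis(2) show ?case
  proof (induction w rule: homogeneous_induct)
    case (basis c)
    show ?case
    proof (induction u rule: cvec_induct)
      case (basis a)
      show ?case
      proof (induction z rule: cvec_induct)
        case (basis d)
        show ?case using \<open>dg' b = k\<close> \<open>dg c = l\<close> by (simp add: tensor_mult_basis)
      qed (simp_all add: cvec.scale_right_distrib mult.commute)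
    qed (simp_all add: cvec.scale_right_distrib mult.commute)
  qed (simp_all add: cvec.scale_right_distrib mult.commute)
qed (simp_all add: cvec.scale_right_distrib mult.commute)

lemma tmul_graded: "graded_algebra tdeg tmul (unit \<otimes> unit')"
proof
  fix x y z :: "('b \<times> 'c) cvec" and k l
  show "tmul (tmul x y) z = tmul x (tmul y z)"
  proof (induction x rule: cvec_induct)
    case (basis b)
    obtain b1 b2 where b: "b = (b1, b2)" by (cases b)
    show ?case
    proof (induction y rule: cvec_induct)
      case (basis c)
      obtain c1 c2 where c: "c = (c1, c2)" by (cases c)
      show ?case
      proof (induction z rule: cvec_induct)
        case (basis d)
        obtain d1 d2 where d: "d = (d1, d2)" by (cases d)
        have 1: "mul' (basis_vec b2) (basis_vec c2) \<in> homogeneous dg' (dg' b2 + dg' c2)"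
          by (simp add: B.mul_degree)
        have 2: "mul (basis_vec c1) (basis_vec d1) \<in> homogeneous dg (dg c1 + dg d1)"
          by (simp add: A.mul_degree)
        have "tmul (tmul (basis_vec b) (basis_vec c)) (basis_vec d)
          = scale ((-1) ^ (dg' b2 * dg c1))
             (tmul (mul (basis_vec b1) (basis_vec c1) \<otimes> mul' (basis_vec b2) (basis_vec c2)) (basis_vec d1 \<otimes> basis_vec d2))"
          by (simp add: b c d tensor_mult_basis)
        also have "\<dots> = scale ((-1) ^ (dg' b2 * dg c1) * (-1) ^ ((dg' b2 + dg' c2) * dg d1))
             (mul (mul (basis_vec b1) (basis_vec c1)) (basis_vec d1) \<otimes>
              mul' (mul' (basis_vec b2) (basis_vec c2)) (basis_vec d2))"
          by (subst tmul_tensor[OF 1]) auto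
        also have "\<dots> = scale ((-1) ^ (dg' c2 * dg d1))
             (tmul (basis_vec b1 \<otimes> basis_vec b2) (mul (basis_vec c1) (basis_vec d1) \<otimes> mul' (basis_vec c2) (basis_vec d2)))"
          by (subst tmul_tensor[OF _ 2])
            (auto simp: A.mul_assoc B.mul_assoc algebra_simps power_add)
        also have "\<dots> = tmul (basis_vec b) (tmul (basis_vec c) (basis_vec d))"
          by (simp add: b c d tensor_mult_basis)
        finally show ?case .
      qed simp_all
    qed simp_all
  qed simp_all
  show "tmul (unit \<otimes> unit') x = x"
  proof (induction x rule: cvec_induct)
    case (basis b)
    obtain b1 b2 where b: "b = (b1, b2)" by (cases b)
    have "tmul (unit \<otimes> unit') (basis_vec b1 \<otimes> basis_vec b2) = basis_vec b1 \<otimes> basis_vec b2"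
      by (subst tmul_tensor[OF B.unit_degree, of _ "dg b1"]) (auto simp: A.mul_unit_left B.mul_unit_left)
    then show ?case by (simp add: b)
  qed simp_all
  show "tmul x (unit \<otimes> unit') = x"
  proof (induction x rule: cvec_induct)
    case (basis b)
    obtain b1 b2 where b: "b = (b1, b2)" by (cases b)
    have "tmul (basis_vec b1 \<otimes> basis_vec b2) (unit \<otimes> unit') = basis_vec b1 \<otimes> basis_vec b2"
      by (subst tmul_tensor[OF _ A.unit_degree, of _ "dg' b2"]) (auto simp: A.mul_unit_right B.mul_unit_right)
    then show ?case by (simp add: b)
  qed simp_all
  show "unit \<otimes> unit' \<in> homogeneous tdeg 0"
    using homogeneous_tensor[OF A.unit_degree B.unit_degree] by simp
  assume x: "x \<in> homogeneous tdeg k" and y: "y \<in> homogeneous tdeg l"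
  from x show "tmul x y \<in> homogeneous tdeg (k + l)"
  proof (induction x rule: homogeneous_induct)
    case (basis b)
    obtain b1 b2 where b: "b = (b1, b2)" by (cases b)
    from y show ?case
    proof (induction y rule: homogeneous_induct)
      case (basis c)
      obtain c1 c2 where c: "c = (c1, c2)" by (cases c)
      have "mul (basis_vec b1) (basis_vec c1) \<otimes> mul' (basis_vec b2) (basis_vec c2)
        \<in> homogeneous tdeg ((dg b1 + dg c1) + (dg' b2 + dg' c2))"
        by (intro homogeneous_tensor A.mul_degree B.mul_degree) simp_all
      then show ?case
        using \<open>tdeg b = k\<close> \<open>tdeg c = l\<close>
        by (auto simp: b c tensor_mult_basis algebra_simps intro!: homogeneous_scale)
    qed simp_all
  qed simp_all
qed (auto intro!: linear_mapI)

end

text \<open>Tensor products of degree-preserving multiplicative maps are multiplicative.\<close>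

lemma tensor_map_mult:
  assumes "graded_algebra_pair dg mul unit dg' mul' unit'"
    and "graded_algebra_pair eg nul vnit eg' nul' vnit'"
    and f: "linear_map f" "\<And>u v. f (mul u v) = nul (f u) (f v)"
      "\<And>u k. u \<in> homogeneous dg k \<Longrightarrow> f u \<in> homogeneous eg k"
    and h: "linear_map h" "\<And>u v. h (mul' u v) = nul' (h u) (h v)"
      "\<And>u k. u \<in> homogeneous dg' k \<Longrightarrow> h u \<in> homogeneous eg' k"
  shows "tensor_map f h (tensor_mult dg mul dg' mul' x y)
    = tensor_mult eg nul eg' nul' (tensor_map f h x) (tensor_map f h y)"
proof -
  interpret P: graded_algebra_pair dg mul unit dg' mul' unit' by fact
  interpret Q: graded_algebra_pair eg nul vnit eg' nul' vnit' by fact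
  show ?thesis
  proof (induction x rule: cvec_induct)
    case (basis b)
    obtain b1 b2 where b: "b = (b1, b2)" by (cases b)
    show ?case
    proof (induction y rule: cvec_induct)
      case (basis c)
      obtain c1 c2 where c: "c = (c1, c2)" by (cases c)
      have "h (basis_vec b2) \<in> homogeneous eg' (dg' b2)" "f (basis_vec c1) \<in> homogeneous eg (dg c1)"
        by (simp_all add: f h)
      from Q.tmul_tensor[OF this] show ?case
        by (simp add: b c tensor_mult_basis tensor_map_tensor f(1,2) h(1,2))
    qed simp_all
  qed simp_all
qed

lemma tensor_assoc_mult:
  assumes "graded_algebra dg mul unit"
  defines "deg2 \<equiv> (\<lambda>(b, c). dg b + dg c)" and "mul2 \<equiv> tensor_mult dg mul dg mul"
  shows "tensor_assoc (tensor_mult deg2 mul2 dg mul x y)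
    = tensor_mult dg mul deg2 mul2 (tensor_assoc x) (tensor_assoc y)"
proof -
  interpret graded_algebra dg mul unit by fact
  interpret P: graded_algebra_pair dg mul unit dg mul unit by unfold_locales
  interpret T: graded_algebra deg2 mul2 "unit \<otimes> unit"
    unfolding deg2_def mul2_def by (rule P.tmul_graded)
  show ?thesis
  proof (induction x rule: cvec_induct)
    case (basis b)
    obtain b1 b2 b3 where b: "b = ((b1, b2), b3)" by (metis surj_pair)
    show ?case
    proof (induction y rule: cvec_induct)
      case (basis c)
      obtain c1 c2 c3 where c: "c = ((c1, c2), c3)" by (metis surj_pair)
      show ?case
        by (simp add: b c tensor_mult_basis mul2_def deg2_def power_add[symmetric] algebra_simps)
    qed simp_all
  qed simp_all
qed

section \<open>The classical exterior algebra\<close>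

abbreviation wedge (infixl "\<curlywedge>" 70) where "a \<curlywedge> b \<equiv> classical_wedge a b"

abbreviation gen_dp :: form where "gen_dp \<equiv> mono_form 0 0 True False"
abbreviation gen_dg :: form where "gen_dg \<equiv> mono_form 0 0 False True"
abbreviation g_pow :: "int \<Rightarrow> form" where "g_pow r \<equiv> mono_form 0 r False False"

lemma form_degree_mono [simp]: "form_degree (n, r, i, j) = of_bool i + of_bool j"
  by (simp add: form_degree_def)

lemma wedge_mono: "mono_form n r i j \<curlywedge> mono_form m s k l = (if i \<and> k \<or> j \<and> l then 0
     else scale (if j \<and> k then -1 else 1) (mono_form (n + m) (r + s) (i \<or> k) (j \<or> l)))"
  by (simp add: classical_wedge_def)

lemma scale_minus_one [simp]: "scale (- 1) v = - v"
  by (simp add: cvec.scale_minus_left)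

lemma scale_two: "scale 2 v = v + v"
  using cvec.scale_left_distrib[of 1 1 v] by simp

lemma wedge_linear [simp]:
  "(u + u') \<curlywedge> v = u \<curlywedge> v + u' \<curlywedge> v" "scale c u \<curlywedge> v = scale c (u \<curlywedge> v)" "0 \<curlywedge> v = 0"
  "u \<curlywedge> (v + v') = u \<curlywedge> v + u \<curlywedge> v'" "u \<curlywedge> scale c v = scale c (u \<curlywedge> v)" "u \<curlywedge> 0 = 0"
  "- u \<curlywedge> v = - (u \<curlywedge> v)" "u \<curlywedge> - v = - (u \<curlywedge> v)"
  "(u - u') \<curlywedge> v = u \<curlywedge> v - u' \<curlywedge> v" "u \<curlywedge> (v - v') = u \<curlywedge> v - u \<curlywedge> v'"
  by (simp_all add: classical_wedge_def)

lemma linear_wedge: "linear_map (\<lambda>u. u \<curlywedge> v)" "linear_map (\<lambda>v. u \<curlywedge> v)"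
  by (rule linear_mapI; simp)+

lemma wedge_assoc: "(a \<curlywedge> b) \<curlywedge> c = a \<curlywedge> (b \<curlywedge> c)"
proof (induction a rule: cvec_induct)
  case (basis x)
  show ?case
  proof (induction b rule: cvec_induct)
    case (basis y)
    show ?case
    proof (induction c rule: cvec_induct)
      case (basis z)
      show ?case
        by (cases x; cases y; cases z) (auto simp: wedge_mono add.assoc)
    qed simp_all
  qed simp_all
qed simp_all

lemma wedge_one [simp]: "one_form \<curlywedge> a = a" "a \<curlywedge> one_form = a"
proof (induction a rule: cvec_induct)
  case (basis b)
  show "one_form \<curlywedge> basis_vec b = basis_vec b" "basis_vec b \<curlywedge> one_form = basis_vec b"
    by (cases b; simp add: one_form_def wedge_mono)+
qed simp_all

interpretation wedge: graded_algebra form_degree classical_wedge one_form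
proof
  show "a \<in> forms k \<Longrightarrow> b \<in> forms l \<Longrightarrow> a \<curlywedge> b \<in> forms (k + l)" for a b k l
  proof (induction a rule: homogeneous_induct)
    case (basis x)
    from basis(2,1) show ?case
    proof (induction b rule: homogeneous_induct)
      case (basis y)
      then show ?case by (cases x; cases y) (auto simp: wedge_mono)
    qed simp_all
  qed simp_all
  show "one_form \<in> forms 0"
    by (simp add: one_form_def)
qed (auto intro: linear_mapI simp: wedge_assoc)

interpretation wedge2: graded_algebra_pair form_degree classical_wedge one_form
  form_degree classical_wedge one_form
  by unfold_locales

abbreviation degree2 :: "mono \<times> mono \<Rightarrow> nat" where
  "degree2 \<equiv> (\<lambda>(b, c). form_degree b + form_degree c)"

abbreviation wedge2 (infixl "\<curlywedge>\<^sub>2" 70) where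
  "x \<curlywedge>\<^sub>2 y \<equiv> tensor_mult form_degree classical_wedge form_degree classical_wedge x y"

interpretation tensor2: graded_algebra degree2 "(\<curlywedge>\<^sub>2)" "one_form \<otimes> one_form"
  by (rule wedge2.tmul_graded)

subsection \<open>A universal property\<close>

lemma (in graded_algebra) mul_pow_add:
  "(mul P ^^ (n + m)) unit = mul ((mul P ^^ n) unit) ((mul P ^^ m) unit)"
  by (induction n) (simp_all add: mul_unit_left mul_assoc)

lemma (in graded_algebra) mul_pow_commute:
  "mul X P = mul P X \<Longrightarrow> mul X ((mul P ^^ n) unit) = mul ((mul P ^^ n) unit) X"
proof (induction n)
  case (Suc n)
  then show ?case by (simp add: mul_assoc) (metis mul_assoc)
qed (simp_all add: mul_unit_left mul_unit_right)

text \<open>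
  The candidate for the algebra map on classical forms that sends \<open>p\<close>, \<open>g\<^sup>r\<close>, \<open>dp\<close>, \<open>dg\<close> to
  \<open>P\<close>, \<open>G r\<close>, \<open>U\<close>, \<open>V\<close>.
\<close>

definition (in graded_algebra) form_hom ::
  "'b cvec \<Rightarrow> (int \<Rightarrow> 'b cvec) \<Rightarrow> 'b cvec \<Rightarrow> 'b cvec \<Rightarrow> form \<Rightarrow> 'b cvec" where
  "form_hom P G U V = lin (\<lambda>(n, r, i, j). mul (mul (mul ((mul P ^^ n) unit) (G r))
     (if i then U else unit)) (if j then V else unit))"

text \<open>
  The classical forms are presented by their generators and the relations assumed here.
\<close>

lemma (in graded_algebra) form_hom_wedge:
  assumes PG: "\<And>r. mul (G r) P = mul P (G r)" and G: "\<And>r s. mul (G r) (G s) = G (r + s)"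
    and UP: "mul U P = mul P U" "mul V P = mul P V"
    and UG: "\<And>r. mul U (G r) = mul (G r) U" "\<And>r. mul V (G r) = mul (G r) V"
    and UV: "mul U U = 0" "mul V V = 0" "mul V U = - mul U V"
  shows "form_hom P G U V (a \<curlywedge> b) = mul (form_hom P G U V a) (form_hom P G U V b)"
proof -
  define K where "K n r = mul ((mul P ^^ n) unit) (G r)" for n r
  note unit = mul_unit_left mul_unit_right
  have KK: "mul (K n r) (K m s) = K (n + m) (r + s)" for n r m s
  proof -
    have "mul (K n r) (K m s) = mul ((mul P ^^ n) unit) (mul (mul (G r) ((mul P ^^ m) unit)) (G s))"
      by (simp add: K_def mul_assoc)
    also have "\<dots> = K (n + m) (r + s)"
      by (simp add: mul_pow_commute[OF PG] mul_pow_add K_def mul_assoc G)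
    finally show ?thesis .
  qed
  have XK: "mul X (K n r) = mul (K n r) X" if "mul X P = mul P X" "\<And>r. mul X (G r) = mul (G r) X" for X n r
    using mul_pow_commute[OF that(1), of n] that(2)[of r] unfolding K_def by (metis mul_assoc)
  have UK: "mul U (K n r) = mul (K n r) U" and VK: "mul V (K n r) = mul (K n r) V" for n r
    by (simp_all add: XK UP UG)
  have KK': "mul (K n r) (mul (K m s) x) = mul (K (n + m) (r + s)) x" for n r m s x
    by (simp add: KK[symmetric] mul_assoc)
  have UK': "mul U (mul (K n r) x) = mul (K n r) (mul U x)"
    and VK': "mul V (mul (K n r) x) = mul (K n r) (mul V x)" for n r x
    by (simp_all add: mul_assoc[symmetric] UK VK)
  have UV': "mul U (mul U x) = 0" "mul V (mul V x) = 0" "mul V (mul U x) = - mul U (mul V x)" for x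
    by (simp_all add: mul_assoc[symmetric] UV)
  have form: "form_hom P G U V (mono_form n r i j)
      = mul (K n r) (mul (if i then U else unit) (if j then V else unit))" for n r i j
    by (simp add: form_hom_def K_def mul_assoc)
  have lin: "form_hom P G U V (x + y) = form_hom P G U V x + form_hom P G U V y"
    "form_hom P G U V (scale c x) = scale c (form_hom P G U V x)"
    "form_hom P G U V 0 = 0" "form_hom P G U V (- x) = - form_hom P G U V x" for x y c
    by (simp_all add: form_hom_def)
  show ?thesis
  proof (induction a rule: cvec_induct)
    case (basis x)
    obtain n r i j where x: "x = (n, r, i, j)" by (cases x)
    show ?case
    proof (induction b rule: cvec_induct)
      case (basis y)
      obtain m s k l where y: "y = (m, s, k, l)" by (cases y)
      show ?case
        unfolding x y wedge_mono form
        by (cases i; cases j; cases k; cases l)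
          (simp_all add: lin form mul_assoc unit KK KK' UK VK UK' VK' UV UV')
    qed (simp_all add: lin)
  qed (simp_all add: lin)
qed

lemma (in graded_algebra) form_hom_values:
  assumes "G 0 = unit"
  shows "form_hom P G U V gen_p = P" "form_hom P G U V (g_pow r) = G r"
    "form_hom P G U V gen_dp = U" "form_hom P G U V gen_dg = V"
  by (simp_all add: form_hom_def gen_p_def assms mul_unit_left mul_unit_right)

text \<open>
  The monomials are products of the generators, so a property closed under products and linear
  combinations need only be checked on the generators.
\<close>

lemma form_generator_induct [case_names p g dp dg wedge add scale]:
  assumes "P gen_p" "\<And>r. P (g_pow r)" "P gen_dp" "P gen_dg"
    and wedge: "\<And>a b. P a \<Longrightarrow> P b \<Longrightarrow> P (a \<curlywedge> b)"
    and "\<And>a b. P a \<Longrightarrow> P b \<Longrightarrow> P (a + b)" "\<And>c a. P a \<Longrightarrow> P (scale c a)"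
  shows "P \<omega>"
proof (induction \<omega> rule: cvec_induct)
  case (basis x)
  obtain n r i j where x: "x = (n, r, i, j)" by (cases x)
  have *: "P (mono_form n r False False)" for n
  proof (induction n)
    case (Suc n)
    have "mono_form (Suc n) r False False = gen_p \<curlywedge> mono_form n r False False"
      by (simp add: gen_p_def wedge_mono)
    with Suc show ?case using assms by simp
  qed (use assms in simp)
  have 1: "P one_form" using assms(2)[of 0] by (simp add: one_form_def)
  have "mono_form n r i j = mono_form n r False False \<curlywedge>
      (if i then gen_dp else one_form) \<curlywedge> (if j then gen_dg else one_form)"
    by (auto simp: wedge_mono)
  then show ?case
    unfolding x using * 1 assms by (auto intro!: wedge)
qed (use assms in auto)

subsection \<open>The differential and the two Lie derivatives\<close>

lemma ext_d_mono: "ext_d (mono_form n r i j) =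
    (if i then 0 else scale (of_nat n) (mono_form (n - 1) r True j))
    + (if j then 0 else scale (if i then - of_int r else of_int r) (mono_form n (r - 1) i True))"
  by (simp add: ext_d_def wedge_mono cvec.scale_minus_left)

lemma linear_ext_d: "linear_map ext_d"
  by (simp add: ext_d_def linear_lin)

lemmas ext_d_linear [simp] = linear_map_add[OF linear_ext_d] linear_map_scale[OF linear_ext_d]
  linear_map_zero[OF linear_ext_d] linear_map_uminus[OF linear_ext_d]

lemma ext_d_degree: "a \<in> forms k \<Longrightarrow> ext_d a \<in> forms (Suc k)"
proof (induction a rule: homogeneous_induct)
  case (basis b)
  then show ?case by (cases b) (auto simp: ext_d_mono split: if_splits)
qed simp_all

lemma ext_d_ext_d: "ext_d (ext_d a) = 0"
proof (induction a rule: cvec_induct)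
  case (basis b)
  then show ?case by (cases b) (auto simp: ext_d_mono)
qed simp_all

lemma ext_d_Leibniz:
  assumes "a \<in> forms k"
  shows "ext_d (a \<curlywedge> b) = ext_d a \<curlywedge> b + scale ((-1) ^ k) (a \<curlywedge> ext_d b)"
  using assms
proof (induction a rule: homogeneous_induct)
  case (basis x)
  obtain n r i j where x: "x = (n, r, i, j)" by (cases x)
  show ?case
  proof (induction b rule: cvec_induct)
    case (basis y)
    obtain m s k' l where y: "y = (m, s, k', l)" by (cases y)
    show ?case
      using \<open>form_degree x = k\<close> unfolding x y
      by (cases n; cases m; cases i; cases j; cases k'; cases l)
        (auto simp: wedge_mono ext_d_mono cvec.scale_left_distrib scale_two algebra_simps)
  qed (simp_all add: cvec.scale_right_distrib algebra_simps)
qed (simp_all add: cvec.scale_right_distrib algebra_simps)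

text \<open>
  The derivation with \<open>p \<mapsto> g\<close>, \<open>dp \<mapsto> dg\<close> and \<open>g, dg \<mapsto> 0\<close>. In \<open>dp \<and> dg\<close> the image of \<open>dp\<close> is killed
  by \<open>dg\<close>.
\<close>

definition lie_left :: "form \<Rightarrow> form" where
  "lie_left = lin (\<lambda>(n, r, i, j). scale (of_nat n) (mono_form (n - 1) (r + 1) i j)
     + (if i \<and> \<not> j then mono_form n r False True else 0))"

text \<open>
  The derivation with \<open>p \<mapsto> 1\<close> and \<open>g, dp, dg \<mapsto> 0\<close>.
\<close>

definition lie_right :: "form \<Rightarrow> form" where
  "lie_right = lin (\<lambda>(n, r, i, j). scale (of_nat n) (mono_form (n - 1) r i j))"

lemma lie_left_mono: "lie_left (mono_form n r i j) = scale (of_nat n) (mono_form (n - 1) (r + 1) i j)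
     + (if i \<and> \<not> j then mono_form n r False True else 0)"
  by (simp add: lie_left_def)

lemma lie_right_mono: "lie_right (mono_form n r i j) = scale (of_nat n) (mono_form (n - 1) r i j)"
  by (simp add: lie_right_def)

lemma linear_lie_left: "linear_map lie_left" and linear_lie_right: "linear_map lie_right"
  by (simp_all add: lie_left_def lie_right_def linear_lin)

lemmas lie_left_linear [simp] = linear_map_add[OF linear_lie_left] linear_map_scale[OF linear_lie_left]
  linear_map_zero[OF linear_lie_left] linear_map_uminus[OF linear_lie_left]

lemmas lie_right_linear [simp] = linear_map_add[OF linear_lie_right] linear_map_scale[OF linear_lie_right]
  linear_map_zero[OF linear_lie_right] linear_map_uminus[OF linear_lie_right]

lemma lie_left_wedge: "lie_left (a \<curlywedge> b) = lie_left a \<curlywedge> b + a \<curlywedge> lie_left b"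
proof (induction a rule: cvec_induct)
  case (basis x)
  obtain n r i j where x: "x = (n, r, i, j)" by (cases x)
  show ?case
  proof (induction b rule: cvec_induct)
    case (basis y)
    obtain m s k l where y: "y = (m, s, k, l)" by (cases y)
    show ?case
      unfolding x y
      by (cases n; cases m; cases i; cases j; cases k; cases l)
        (auto simp: wedge_mono lie_left_mono cvec.scale_left_distrib scale_two algebra_simps)
  qed (simp_all add: cvec.scale_right_distrib algebra_simps)
qed (simp_all add: cvec.scale_right_distrib algebra_simps)

lemma lie_right_wedge: "lie_right (a \<curlywedge> b) = lie_right a \<curlywedge> b + a \<curlywedge> lie_right b"
proof (induction a rule: cvec_induct)
  case (basis x)
  obtain n r i j where x: "x = (n, r, i, j)" by (cases x)
  show ?case
  proof (induction b rule: cvec_induct)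
    case (basis y)
    obtain m s k l where y: "y = (m, s, k, l)" by (cases y)
    show ?case
      unfolding x y
      by (cases n; cases m; cases i; cases j; cases k; cases l)
        (auto simp: wedge_mono lie_right_mono cvec.scale_left_distrib scale_two algebra_simps)
  qed (simp_all add: cvec.scale_right_distrib algebra_simps)
qed (simp_all add: cvec.scale_right_distrib algebra_simps)

lemma lie_left_degree: "a \<in> forms k \<Longrightarrow> lie_left a \<in> forms k"
proof (induction a rule: homogeneous_induct)
  case (basis b)
  then show ?case by (cases b) (auto simp: lie_left_mono split: if_splits)
qed simp_all

lemma lie_right_degree: "a \<in> forms k \<Longrightarrow> lie_right a \<in> forms k"
proof (induction a rule: homogeneous_induct)
  case (basis b)
  then show ?case by (cases b) (auto simp: lie_right_mono)
qed simp_all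

lemma ext_d_lie_left: "ext_d (lie_left a) = lie_left (ext_d a)"
proof (induction a rule: cvec_induct)
  case (basis b)
  obtain n r i j where b: "b = (n, r, i, j)" by (cases b)
  show ?case unfolding b
    by (cases n; cases i; cases j)
      (auto simp: lie_left_mono ext_d_mono cvec.scale_left_distrib cvec.scale_right_distrib algebra_simps)
qed simp_all

lemma ext_d_lie_right: "ext_d (lie_right a) = lie_right (ext_d a)"
proof (induction a rule: cvec_induct)
  case (basis b)
  obtain n r i j where b: "b = (n, r, i, j)" by (cases b)
  show ?case unfolding b
    by (cases n; cases i; cases j)
      (auto simp: lie_right_mono ext_d_mono cvec.scale_right_distrib algebra_simps)
qed simp_all

lemma lie_left_lie_right: "lie_left (lie_right a) = lie_right (lie_left a)"
proof (induction a rule: cvec_induct)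
  case (basis b)
  obtain n r i j where b: "b = (n, r, i, j)" by (cases b)
  show ?case unfolding b
    by (cases n; cases i; cases j)
      (auto simp: lie_right_mono lie_left_mono cvec.scale_right_distrib algebra_simps)
qed simp_all

subsection \<open>The coproduct\<close>

lemma cop_p_eq: "cop_p = basis_vec ((1, 0, False, False), (0, 1, False, False))
    + basis_vec ((0, 0, False, False), (1, 0, False, False))"
  by (simp add: cop_p_def gen_p_def gen_g_def one_form_def)

lemma cop_g_pow_eq: "cop_g_pow r = basis_vec ((0, r, False, False), (0, r, False, False))"
  by (simp add: cop_g_pow_def)

text \<open>
  The coproducts of \<open>dp\<close> and \<open>dg\<close>, that is, the differentials of those of \<open>p\<close> and \<open>g\<close>.
\<close>

abbreviation cop_dp :: "(mono \<times> mono) cvec" where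
  "cop_dp \<equiv> gen_dp \<otimes> gen_g + gen_p \<otimes> gen_dg + one_form \<otimes> gen_dp"

abbreviation cop_dg :: "(mono \<times> mono) cvec" where
  "cop_dg \<equiv> gen_dg \<otimes> gen_g + gen_g \<otimes> gen_dg"

lemma diff_cop_p: "super_tensor_diff form_degree ext_d cop_p = cop_dp"
  and diff_cop_g: "super_tensor_diff form_degree ext_d (cop_g_pow 1) = cop_dg"
  by (simp_all add: super_tensor_diff_def cop_p_eq cop_g_pow_eq ext_d_mono gen_p_def gen_g_def one_form_def)

lemma form_cop_eq_hom: "form_cop = tensor2.form_hom cop_p cop_g_pow cop_dp cop_dg"
  unfolding form_cop_def tensor2.form_hom_def Let_def super_tensor_mult_eq diff_cop_p diff_cop_g ..

lemma linear_form_cop: "linear_map form_cop"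
  unfolding form_cop_eq_hom tensor2.form_hom_def by (rule linear_lin)

lemmas form_cop_linear [simp] = linear_map_add[OF linear_form_cop] linear_map_scale[OF linear_form_cop]
  linear_map_zero[OF linear_form_cop] linear_map_uminus[OF linear_form_cop]

lemma form_cop_wedge: "form_cop (a \<curlywedge> b) = form_cop a \<curlywedge>\<^sub>2 form_cop b"
  unfolding form_cop_eq_hom
  by (rule tensor2.form_hom_wedge)
    (auto simp: cop_p_eq cop_g_pow_eq gen_p_def gen_g_def one_form_def tensor_mult_basis wedge_mono algebra_simps)

lemma form_cop_values [simp]: "form_cop gen_p = cop_p" "form_cop (g_pow r) = cop_g_pow r"
    "form_cop gen_dp = cop_dp" "form_cop gen_dg = cop_dg"
  unfolding form_cop_eq_hom
  by (rule tensor2.form_hom_values; simp add: cop_g_pow_eq one_form_def)+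

lemma form_cop_one [simp]: "form_cop one_form = one_form \<otimes> one_form"
  using form_cop_values(2)[of 0] by (simp add: cop_g_pow_def one_form_def)

subsection \<open>Counit, weights and coassociativity\<close>

lemma form_counit_mono [simp]: "form_counit (mono_form n r i j) = (if n = 0 \<and> \<not> i \<and> \<not> j then 1 else 0)"
  by (simp add: form_counit_def)

lemma form_counit_linear [simp]: "form_counit (u + v) = form_counit u + form_counit v"
  "form_counit (scale c u) = c * form_counit u"
  by (simp_all add: form_counit_def)

lemma linear_form_counit: "Vector_Spaces.linear scale (*) form_counit"
  by unfold_locales (simp_all add: algebra_simps)

lemma form_counit_wedge: "form_counit (a \<curlywedge> b) = form_counit a * form_counit b"
proof (induction a rule: cvec_induct)
  case (basis x)
  show ?case
  proof (induction b rule: cvec_induct)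
    case (basis y)
    show ?case
      using form_counit_linear(2)[of "-1"] form_counit_linear(2)[of 0]
      by (cases x; cases y) (auto simp: wedge_mono)
  qed (simp_all add: algebra_simps)
qed (simp_all add: algebra_simps)

lemma counit_left_wedge2:
  fixes x y :: "(mono \<times> mono) cvec"
  defines "K \<equiv> \<lambda>x. lin (\<lambda>(b, c). scale (form_counit (basis_vec b)) (basis_vec c)) x"
  shows "K (x \<curlywedge>\<^sub>2 y) = K x \<curlywedge> K y"
proof (induction x rule: cvec_induct)
  case (basis b)
  obtain b1 b2 where b: "b = (b1, b2)" by (cases b)
  show ?case
  proof (induction y rule: cvec_induct)
    case (basis c)
    obtain c1 c2 where c: "c = (c1, c2)" by (cases c)
    show ?case
      by (cases b1; cases c1)
        (auto simp: b c K_def tensor_mult_basis lin_tensor lin_scale_fun wedge_mono)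
  qed (simp_all add: K_def)
qed (simp_all add: K_def)

lemma counit_right_wedge2:
  fixes x y :: "(mono \<times> mono) cvec"
  defines "K \<equiv> \<lambda>x. lin (\<lambda>(b, c). scale (form_counit (basis_vec c)) (basis_vec b)) x"
  shows "K (x \<curlywedge>\<^sub>2 y) = K x \<curlywedge> K y"
proof (induction x rule: cvec_induct)
  case (basis b)
  obtain b1 b2 where b: "b = (b1, b2)" by (cases b)
  show ?case
  proof (induction y rule: cvec_induct)
    case (basis c)
    obtain c1 c2 where c: "c = (c1, c2)" by (cases c)
    show ?case
      by (cases b2; cases c2)
        (auto simp: b c K_def tensor_mult_basis lin_tensor lin_scale_fun wedge_mono)
  qed (simp_all add: K_def)
qed (simp_all add: K_def)

lemma form_counit_left:
  "lin (\<lambda>(b, c). scale (form_counit (basis_vec b)) (basis_vec c)) (form_cop a) = a"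
  by (induction a rule: form_generator_induct)
    (simp_all add: counit_left_wedge2 form_cop_wedge, simp_all add: cop_p_eq cop_g_pow_eq gen_p_def gen_g_def one_form_def)

lemma form_counit_right:
  "lin (\<lambda>(b, c). scale (form_counit (basis_vec c)) (basis_vec b)) (form_cop a) = a"
  by (induction a rule: form_generator_induct)
    (simp_all add: counit_right_wedge2 form_cop_wedge, simp_all add: cop_p_eq cop_g_pow_eq gen_p_def gen_g_def one_form_def)

text \<open>
  The left and right weights of a monomial: \<open>p\<close> and \<open>dp\<close> have weights \<open>(0, 1)\<close>, while \<open>g\<close> and \<open>dg\<close> have
  weights \<open>(1, 1)\<close>.
\<close>

definition wt_left :: "mono \<Rightarrow> int" where
  "wt_left = (\<lambda>(n, r, i, j). r + of_bool j)"

definition wt_right :: "mono \<Rightarrow> int" where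
  "wt_right = (\<lambda>(n, r, i, j). int n + r + of_bool i + of_bool j)"

lemma wt_mono [simp]: "wt_left (n, r, i, j) = r + of_bool j"
  "wt_right (n, r, i, j) = int n + r + of_bool i + of_bool j"
  by (simp_all add: wt_left_def wt_right_def)

text \<open>
  Pairs of monomials whose weights compose like the arrows \<open>l \<rightarrow> m \<rightarrow> r\<close>, for any \<open>m\<close>, and whose degrees
  add up to \<open>k\<close>.
\<close>

definition paths :: "int \<Rightarrow> int \<Rightarrow> nat \<Rightarrow> (mono \<times> mono) set" where
  "paths l r k = {(b, c). wt_left b = l \<and> wt_right b = wt_left c \<and> wt_right c = r \<and>
     form_degree b + form_degree c = k}"

lemma keys_wedge_basis:
  "Poly_Mapping.keys (basis_vec b \<curlywedge> basis_vec c) \<subseteq> {d. wt_left d = wt_left b + wt_left c \<and>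
     wt_right d = wt_right b + wt_right c \<and> form_degree d = form_degree b + form_degree c}"
  by (cases b; cases c) (auto simp: wedge_mono in_keys_iff lookup_single when_def split: if_splits)

lemma keys_add_subset:
  "Poly_Mapping.keys u \<subseteq> K \<Longrightarrow> Poly_Mapping.keys v \<subseteq> K \<Longrightarrow> Poly_Mapping.keys (u + v) \<subseteq> K"
  using Poly_Mapping.keys_add by fastforce

lemma keys_scale_subset: "Poly_Mapping.keys u \<subseteq> K \<Longrightarrow> Poly_Mapping.keys (scale c u) \<subseteq> K"
  by (auto simp: in_keys_iff)

lemma keys_tensor:
  assumes "Poly_Mapping.keys u \<subseteq> K" "Poly_Mapping.keys v \<subseteq> L"
  shows "Poly_Mapping.keys (u \<otimes> v) \<subseteq> K \<times> L"
  using assms(1)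
proof (induction u rule: supported_induct)
  case (basis b)
  from assms(2) show ?case
    by (induction v rule: supported_induct)
      (simp_all add: keys_add_subset keys_scale_subset basis)
qed (simp_all add: keys_add_subset keys_scale_subset)

lemma paths_wedge2:
  assumes "Poly_Mapping.keys x \<subseteq> paths l r k" "Poly_Mapping.keys y \<subseteq> paths l' r' k'"
  shows "Poly_Mapping.keys (x \<curlywedge>\<^sub>2 y) \<subseteq> paths (l + l') (r + r') (k + k')"
  using assms(1)
proof (induction x rule: supported_induct)
  case (basis b)
  obtain b1 b2 where b: "b = (b1, b2)" by (cases b)
  from assms(2) show ?case
  proof (induction y rule: supported_induct)
    case (basis c)
    obtain c1 c2 where c: "c = (c1, c2)" by (cases c)
    have "Poly_Mapping.keys (basis_vec b \<curlywedge>\<^sub>2 basis_vec c)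
        \<subseteq> Poly_Mapping.keys (basis_vec b1 \<curlywedge> basis_vec c1) \<times> Poly_Mapping.keys (basis_vec b2 \<curlywedge> basis_vec c2)"
      unfolding b c tensor_mult_basis by (intro keys_scale_subset keys_tensor order_refl)
    also have "\<dots> \<subseteq> paths (l + l') (r + r') (k + k')"
      using keys_wedge_basis[of b1 c1] keys_wedge_basis[of b2 c2] basis \<open>b \<in> paths l r k\<close>
      by (fastforce simp: paths_def b c)
    finally show ?case .
  qed (simp_all add: keys_add_subset keys_scale_subset)
qed (simp_all add: keys_add_subset keys_scale_subset)

lemma keys_cop_p: "Poly_Mapping.keys cop_p \<subseteq> paths 0 1 0"
  using Poly_Mapping.keys_add unfolding cop_p_eq by (fastforce simp: paths_def)

lemma keys_cop_g: "Poly_Mapping.keys (cop_g_pow r) \<subseteq> paths r r 0"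
  unfolding cop_g_pow_eq by (auto simp: paths_def)

lemma keys_cop_dp: "Poly_Mapping.keys cop_dp \<subseteq> paths 0 1 1"
proof -
  have "Poly_Mapping.keys cop_dp \<subseteq> {((0, 0, True, False), (0, 1, False, False)),
      ((1, 0, False, False), (0, 0, False, True)), ((0, 0, False, False), (0, 0, True, False))}"
    unfolding gen_p_def gen_g_def one_form_def tensor_basis
    by (intro order_trans[OF Poly_Mapping.keys_add] Un_least) auto
  then show ?thesis by (auto simp: paths_def)
qed

lemma keys_cop_dg: "Poly_Mapping.keys cop_dg \<subseteq> paths 1 1 1"
  using Poly_Mapping.keys_add unfolding gen_g_def tensor_basis by (fastforce simp: paths_def)

lemma keys_form_cop:
  "Poly_Mapping.keys (form_cop (basis_vec a)) \<subseteq> paths (wt_left a) (wt_right a) (form_degree a)"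
proof -
  obtain n r i j where a: "a = (n, r, i, j)" by (cases a)
  have 0: "Poly_Mapping.keys (form_cop (mono_form n r False False)) \<subseteq> paths r (int n + r) 0"
  proof (induction n)
    case 0
    show ?case using keys_cop_g by simp
  next
    case (Suc n)
    have "mono_form (Suc n) r False False = gen_p \<curlywedge> mono_form n r False False"
      by (simp add: gen_p_def wedge_mono)
    with paths_wedge2[OF keys_cop_p Suc] show ?case
      by (simp add: form_cop_wedge algebra_simps)
  qed
  have 1: "Poly_Mapping.keys (form_cop (mono_form n r i False))
      \<subseteq> paths r (int n + r + of_bool i) (of_bool i)"
  proof (cases i)
    case True
    have "mono_form n r True False = mono_form n r False False \<curlywedge> gen_dp"
      by (simp add: wedge_mono)
    with paths_wedge2[OF 0 keys_cop_dp] True show ?thesis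
      by (simp add: form_cop_wedge)
  qed (use 0 in simp)
  show ?thesis
  proof (cases j)
    case True
    have "mono_form n r i True = mono_form n r i False \<curlywedge> gen_dg"
      by (simp add: wedge_mono)
    with paths_wedge2[OF 1 keys_cop_dg] True show ?thesis
      by (simp add: form_cop_wedge a)
  qed (use 1 in \<open>simp add: a\<close>)
qed

lemma form_cop_keyD:
  assumes "(b, c) \<in> Poly_Mapping.keys (form_cop (basis_vec a))"
  shows "wt_left b = wt_left a" "wt_right b = wt_left c" "wt_right c = wt_right a"
    "form_degree b + form_degree c = form_degree a"
  using keys_form_cop[of a] assms by (auto simp: paths_def)

lemma form_cop_degree: "a \<in> forms k \<Longrightarrow> form_cop a \<in> homogeneous degree2 k"
proof (induction a rule: homogeneous_induct)
  case (basis b)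
  then show ?case by (auto simp: homogeneous_def dest: form_cop_keyD)
qed simp_all

interpretation tensor_left: graded_algebra_pair degree2 "(\<curlywedge>\<^sub>2)" "one_form \<otimes> one_form"
  form_degree classical_wedge one_form
  by unfold_locales

interpretation tensor_right: graded_algebra_pair form_degree classical_wedge one_form
  degree2 "(\<curlywedge>\<^sub>2)" "one_form \<otimes> one_form"
  by unfold_locales

lemma form_coassoc:
  "tensor_assoc (tensor_map form_cop id (form_cop a)) = tensor_map id form_cop (form_cop a)"
proof (induction a rule: form_generator_induct)
  case (wedge a b)
  have "tensor_map form_cop id (x \<curlywedge>\<^sub>2 y) = tensor_mult degree2 (\<curlywedge>\<^sub>2) form_degree (\<curlywedge>)
      (tensor_map form_cop id x) (tensor_map form_cop id y)" for x y
    by (rule tensor_map_mult[OF wedge2.graded_algebra_pair_axioms tensor_left.graded_algebra_pair_axioms])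
      (simp_all add: linear_form_cop linear_id form_cop_wedge form_cop_degree)
  moreover have "tensor_map id form_cop (x \<curlywedge>\<^sub>2 y) = tensor_mult form_degree (\<curlywedge>) degree2 (\<curlywedge>\<^sub>2)
      (tensor_map id form_cop x) (tensor_map id form_cop y)" for x y
    by (rule tensor_map_mult[OF wedge2.graded_algebra_pair_axioms tensor_right.graded_algebra_pair_axioms])
      (simp_all add: linear_form_cop linear_id form_cop_wedge form_cop_degree)
  ultimately show ?case
    by (simp only: form_cop_wedge tensor_assoc_mult[OF wedge.graded_algebra_axioms] wedge)
next
  case p
  have "tensor_map form_cop id cop_p = form_cop gen_p \<otimes> gen_g + form_cop one_form \<otimes> gen_p"
    "tensor_map id form_cop cop_p = gen_p \<otimes> form_cop gen_g + one_form \<otimes> form_cop gen_p"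
    by (simp_all add: cop_p_def tensor_map_tensor linear_id linear_form_cop del: form_cop_values form_cop_one)
  then show ?case
    by (simp add: gen_g_def) (simp add: cop_p_eq cop_g_pow_eq gen_p_def gen_g_def one_form_def)
next
  case dp
  have "tensor_map form_cop id cop_dp = form_cop gen_dp \<otimes> gen_g + form_cop gen_p \<otimes> gen_dg + form_cop one_form \<otimes> gen_dp"
    "tensor_map id form_cop cop_dp = gen_dp \<otimes> form_cop gen_g + gen_p \<otimes> form_cop gen_dg + one_form \<otimes> form_cop gen_dp"
    by (simp_all add: tensor_map_tensor linear_id linear_form_cop del: form_cop_values form_cop_one)
  then show ?case
    by (simp add: gen_g_def) (simp add: cop_p_eq cop_g_pow_eq gen_p_def gen_g_def one_form_def)
next
  case dg
  have "tensor_map form_cop id cop_dg = form_cop gen_dg \<otimes> gen_g + form_cop gen_g \<otimes> gen_dg"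
    "tensor_map id form_cop cop_dg = gen_dg \<otimes> form_cop gen_g + gen_g \<otimes> form_cop gen_dg"
    by (simp_all add: tensor_map_tensor linear_id linear_form_cop del: form_cop_values form_cop_one)
  then show ?case
    by (simp add: gen_g_def) (simp add: cop_p_eq cop_g_pow_eq gen_p_def gen_g_def one_form_def)
next
  case (g r)
  then show ?case by (simp add: cop_g_pow_def tensor_map_tensor linear_id linear_form_cop)
qed simp_all

lemma lin_tensor_assoc_map:
  "lin (\<lambda>(a, b, c). F a b c) (tensor_assoc (tensor_map f id x))
    = lin (\<lambda>(u, c). lin (\<lambda>(a, b). F a b c) (f (basis_vec u))) x"
proof (induction x rule: cvec_induct)
  case (basis u)
  obtain v c where u: "u = (v, c)" by (cases u)
  have "lin (\<lambda>(a, b, c). F a b c) (tensor_assoc (y \<otimes> basis_vec c)) = lin (\<lambda>(a, b). F a b c) y" for y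
    by (induction y rule: cvec_induct) (simp_all add: split_paired_all)
  then show ?case by (simp add: u)
qed simp_all

lemma lin_tensor_map_right:
  "lin (\<lambda>(a, b, c). F a b c) (tensor_map id f x)
    = lin (\<lambda>(a, u). lin (\<lambda>(b, c). F a b c) (f (basis_vec u))) x"
proof (induction x rule: cvec_induct)
  case (basis u)
  obtain a v where u: "u = (a, v)" by (cases u)
  have "lin (\<lambda>(a, b, c). F a b c) (basis_vec a \<otimes> y) = lin (\<lambda>(b, c). F a b c) y" for y
    by (induction y rule: cvec_induct) (simp_all add: split_paired_all)
  then show ?case by (simp add: u)
qed simp_all

text \<open>
  Coassociativity in Sweedler form, for an arbitrary function of the three legs.
\<close>

lemma form_coassoc_lin:
  "lin (\<lambda>(u, c). lin (\<lambda>(a, b). F a b c) (form_cop (basis_vec u))) (form_cop x)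
    = lin (\<lambda>(a, u). lin (\<lambda>(b, c). F a b c) (form_cop (basis_vec u))) (form_cop x)"
  using lin_tensor_assoc_map[of F form_cop "form_cop x"] lin_tensor_map_right[of F form_cop "form_cop x"]
  by (simp add: form_coassoc)

subsection \<open>The coproduct and the Lie derivatives\<close>

text \<open>
  An even derivation applied to one leg is a derivation of the super tensor square.
\<close>

lemma tensor_map_derivation_left:
  assumes "linear_map f" "\<And>a b. f (a \<curlywedge> b) = f a \<curlywedge> b + a \<curlywedge> f b" "\<And>a k. a \<in> forms k \<Longrightarrow> f a \<in> forms k"
  shows "tensor_map f id (x \<curlywedge>\<^sub>2 y) = tensor_map f id x \<curlywedge>\<^sub>2 y + x \<curlywedge>\<^sub>2 tensor_map f id y"
proof (induction x rule: cvec_induct)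
  case (basis b)
  obtain b1 b2 where b: "b = (b1, b2)" by (cases b)
  show ?case
  proof (induction y rule: cvec_induct)
    case (basis c)
    obtain c1 c2 where c: "c = (c1, c2)" by (cases c)
    have "(basis_vec b1 \<otimes> basis_vec b2) \<curlywedge>\<^sub>2 (f (basis_vec c1) \<otimes> basis_vec c2)
      = scale ((-1) ^ (form_degree b2 * form_degree c1)) (basis_vec b1 \<curlywedge> f (basis_vec c1) \<otimes> basis_vec b2 \<curlywedge> basis_vec c2)"
      by (rule wedge2.tmul_tensor) (simp_all add: assms)
    moreover have "(f (basis_vec b1) \<otimes> basis_vec b2) \<curlywedge>\<^sub>2 (basis_vec c1 \<otimes> basis_vec c2)
      = scale ((-1) ^ (form_degree b2 * form_degree c1)) (f (basis_vec b1) \<curlywedge> basis_vec c1 \<otimes> basis_vec b2 \<curlywedge> basis_vec c2)"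
      by (rule wedge2.tmul_tensor) simp_all
    ultimately show ?case
      by (simp add: b c tensor_mult_basis tensor_map_tensor linear_id assms cvec.scale_right_distrib)
  qed (simp_all add: cvec.scale_right_distrib algebra_simps)
qed (simp_all add: cvec.scale_right_distrib algebra_simps)

lemma tensor_map_derivation_right:
  assumes "linear_map f" "\<And>a b. f (a \<curlywedge> b) = f a \<curlywedge> b + a \<curlywedge> f b" "\<And>a k. a \<in> forms k \<Longrightarrow> f a \<in> forms k"
  shows "tensor_map id f (x \<curlywedge>\<^sub>2 y) = tensor_map id f x \<curlywedge>\<^sub>2 y + x \<curlywedge>\<^sub>2 tensor_map id f y"
proof (induction x rule: cvec_induct)
  case (basis b)
  obtain b1 b2 where b: "b = (b1, b2)" by (cases b)
  show ?case
  proof (induction y rule: cvec_induct)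
    case (basis c)
    obtain c1 c2 where c: "c = (c1, c2)" by (cases c)
    have "(basis_vec b1 \<otimes> f (basis_vec b2)) \<curlywedge>\<^sub>2 (basis_vec c1 \<otimes> basis_vec c2)
      = scale ((-1) ^ (form_degree b2 * form_degree c1)) (basis_vec b1 \<curlywedge> basis_vec c1 \<otimes> f (basis_vec b2) \<curlywedge> basis_vec c2)"
      by (rule wedge2.tmul_tensor) (simp_all add: assms)
    moreover have "(basis_vec b1 \<otimes> basis_vec b2) \<curlywedge>\<^sub>2 (basis_vec c1 \<otimes> f (basis_vec c2))
      = scale ((-1) ^ (form_degree b2 * form_degree c1)) (basis_vec b1 \<curlywedge> basis_vec c1 \<otimes> basis_vec b2 \<curlywedge> f (basis_vec c2))"
      by (rule wedge2.tmul_tensor) simp_all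
    ultimately show ?case
      by (simp add: b c tensor_mult_basis tensor_map_tensor linear_id assms cvec.scale_right_distrib)
  qed (simp_all add: cvec.scale_right_distrib algebra_simps)
qed (simp_all add: cvec.scale_right_distrib algebra_simps)

lemmas lie_left_derivation = linear_lie_left lie_left_wedge lie_left_degree
lemmas lie_right_derivation = linear_lie_right lie_right_wedge lie_right_degree

lemma lie_generators:
  "lie_left gen_p = gen_g" "lie_left (g_pow r) = 0" "lie_left gen_dp = gen_dg" "lie_left gen_dg = 0"
  "lie_right gen_p = one_form" "lie_right (g_pow r) = 0" "lie_right gen_dp = 0" "lie_right gen_dg = 0"
  by (simp_all add: lie_left_mono lie_right_mono gen_p_def gen_g_def one_form_def)

lemma form_cop_gen_g: "form_cop gen_g = gen_g \<otimes> gen_g"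
  using form_cop_values(2)[of 1] by (simp add: gen_g_def cop_g_pow_def)

text \<open>
  The derivations come from the left and the right coaction: they commute with the coproduct on the
  outer legs, and on the inner legs they are exchanged.
\<close>

lemma form_cop_lie_left: "form_cop (lie_left a) = tensor_map lie_left id (form_cop a)"
proof (induction a rule: form_generator_induct)
  case (wedge a b)
  then show ?case
    by (simp only: lie_left_wedge form_cop_linear form_cop_wedge tensor_map_derivation_left[OF lie_left_derivation])
qed (simp_all add: lie_generators form_cop_gen_g,
  simp_all add: cop_p_eq cop_g_pow_eq lie_left_mono gen_p_def gen_g_def one_form_def)

lemma form_cop_lie_right: "form_cop (lie_right a) = tensor_map id lie_right (form_cop a)"
proof (induction a rule: form_generator_induct)
  case (wedge a b)
  then show ?case
    by (simp only: lie_right_wedge form_cop_linear form_cop_wedge tensor_map_derivation_right[OF lie_right_derivation])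
qed (simp_all add: lie_generators form_cop_gen_g,
  simp_all add: cop_p_eq cop_g_pow_eq lie_right_mono gen_p_def gen_g_def one_form_def)

lemma form_cop_lie_middle: "tensor_map lie_right id (form_cop a) = tensor_map id lie_left (form_cop a)"
proof (induction a rule: form_generator_induct)
  case (wedge a b)
  then show ?case
    by (simp only: form_cop_wedge tensor_map_derivation_left[OF lie_right_derivation]
        tensor_map_derivation_right[OF lie_left_derivation])
qed (simp_all, simp_all add: cop_p_eq cop_g_pow_eq lie_right_mono lie_left_mono gen_p_def gen_g_def one_form_def)

section \<open>Integer powers of unipotent operators\<close>

text \<open>
  A family \<open>F c\<close> that behaves like the integer powers of \<open>X\<close>; in particular \<open>X\<close> is invertible, with
  inverse \<open>F (-1)\<close>.
\<close>

locale int_flow =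
  fixes X :: "'v \<Rightarrow> 'v" and F :: "int \<Rightarrow> 'v \<Rightarrow> 'v"
  assumes flow_0: "F 0 v = v"
    and flow_step: "F (c + 1) v = X (F c v)"
    and flow_step': "F (c + 1) v = F c (X v)"
begin

lemma flow_back: "X (F (c - 1) v) = F c v"
  using flow_step[of "c - 1" v] by simp

lemma step_cancel: "X v = X w \<longleftrightarrow> v = w"
proof
  assume "X v = X w"
  then show "v = w"
    using flow_step'[of "- 1" v] flow_step'[of "- 1" w] by (simp add: flow_0)
qed simp

lemma flow_1: "F 1 v = X v"
  using flow_step[of 0 v] by (simp add: flow_0)

lemma flow_add: "F c (F e v) = F (c + e) v"
proof (induction c rule: int_induct[of _ 0])
  case (step1 i)
  then show ?case
    using flow_step[of "i + e" v] flow_step[of i "F e v"] by (simp add: algebra_simps)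
next
  case (step2 i)
  have "X (F (i - 1) (F e v)) = X (F (i - 1 + e) v)"
    using step2 flow_back[of "i + e" v] by (simp add: flow_back algebra_simps)
  then show ?case by (simp add: step_cancel)
qed (simp add: flow_0)

lemma flow_commute:
  assumes "\<And>v. Q (X v) = X (Q v)"
  shows "Q (F c v) = F c (Q v)"
proof (induction c rule: int_induct[of _ 0])
  case (step2 i)
  have "X (Q (F (i - 1) v)) = X (F (i - 1) (Q v))"
    using step2 by (simp add: assms[symmetric] flow_back)
  then show ?case by (simp add: step_cancel)
qed (simp_all add: flow_0 flow_step assms)

lemma flow_mult:
  assumes "\<And>v w. X (m v w) = m (X v) (X w)"
  shows "F c (m v w) = m (F c v) (F c w)"
proof (induction c rule: int_induct[of _ 0])
  case (step2 i)
  have "X (F (i - 1) (m v w)) = X (m (F (i - 1) v) (F (i - 1) w))"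
    using step2 by (simp add: assms flow_back)
  then show ?case by (simp add: step_cancel)
qed (simp_all add: flow_0 flow_step assms)

end

text \<open>
  The functional on \<open>C(B\<^sub>+)\<close> with \<open>p\<^sup>n g\<^sup>r \<mapsto> t\<^sup>n c (c - 1) \<dots> (c - n + 1)\<close>, extended by zero to positive degree.
  If \<open>E\<close> is the functional with \<open>p\<^sup>n g\<^sup>r \<mapsto> 1\<close> for \<open>n = 1\<close> and \<open>0\<close> otherwise, this is the convolution power
  \<open>(1 + t E)\<^sup>c\<close>.
\<close>

definition chi :: "complex \<Rightarrow> int \<Rightarrow> mono \<Rightarrow> complex" where
  "chi t c = (\<lambda>(n, r, i, j). if i \<or> j then 0 else t ^ n * (\<Prod>q<n. of_int c - of_nat q))"

text \<open>
  Pairing \<^const>\<open>chi\<close> with a leg of the coproduct gives the integer powers of \<open>1 + t E\<^sub>L\<close> and \<open>1 + t E\<^sub>R\<close>.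
\<close>

definition shift_left :: "complex \<Rightarrow> int \<Rightarrow> form \<Rightarrow> form" where
  "shift_left t c a = lin (\<lambda>(b, u). scale (chi t c b) (basis_vec u)) (form_cop a)"

definition shift_right :: "complex \<Rightarrow> int \<Rightarrow> form \<Rightarrow> form" where
  "shift_right t c a = lin (\<lambda>(u, b). scale (chi t c b) (basis_vec u)) (form_cop a)"

lemma chi_zero: "chi t 0 b = form_counit (basis_vec b)"
proof -
  obtain n r i j where b: "b = (n, r, i, j)" by (cases b)
  have "(\<Prod>q<n. - complex_of_nat q) = 0" if "n \<noteq> 0"
    using that by (intro prod_zero) auto
  then show ?thesis by (simp add: b chi_def)
qed

lemma falling_factorial_step:
  fixes x :: complex
  shows "(\<Prod>q<Suc m. x - of_nat q) + of_nat (Suc m) * (\<Prod>q<m. x - of_nat q) = (\<Prod>q<Suc m. (x + 1) - of_nat q)"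
proof -
  have "(\<Prod>q<Suc m. (x + 1) - of_nat q) = (x + 1) * (\<Prod>q<m. x - of_nat q)"
    by (subst prod.lessThan_Suc_shift) simp
  then show ?thesis by (simp add: algebra_simps)
qed

lemma linear_shift_left: "linear_map (shift_left t c)"
  and linear_shift_right: "linear_map (shift_right t c)"
  by (rule linear_mapI; simp add: shift_left_def shift_right_def)+

lemmas shift_left_linear [simp] = linear_map_add[OF linear_shift_left] linear_map_scale[OF linear_shift_left]
  linear_map_zero[OF linear_shift_left] linear_map_uminus[OF linear_shift_left]

lemmas shift_right_linear [simp] = linear_map_add[OF linear_shift_right] linear_map_scale[OF linear_shift_right]
  linear_map_zero[OF linear_shift_right] linear_map_uminus[OF linear_shift_right]

text \<open>
  The operators \<open>X = 1 + t E\<^sub>L\<close> and \<open>Y = 1 + t E\<^sub>R\<close>, whose powers the shifts turn out to be.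
\<close>

definition step_left :: "complex \<Rightarrow> form \<Rightarrow> form" where
  "step_left t a = a + scale t (lie_left a)"

definition step_right :: "complex \<Rightarrow> form \<Rightarrow> form" where
  "step_right t a = a + scale t (lie_right a)"

lemma step_left_linear [simp]:
  "step_left t (a + b) = step_left t a + step_left t b" "step_left t (scale c a) = scale c (step_left t a)"
  "step_left t 0 = 0" "step_left t (- a) = - step_left t a"
  by (simp_all add: step_left_def cvec.scale_right_distrib algebra_simps)

lemma step_right_linear [simp]:
  "step_right t (a + b) = step_right t a + step_right t b" "step_right t (scale c a) = scale c (step_right t a)"
  "step_right t 0 = 0" "step_right t (- a) = - step_right t a"
  by (simp_all add: step_right_def cvec.scale_right_distrib algebra_simps)

lemma chi_step_left:
  "lin (\<lambda>b. scale (chi t c b) u) (step_left t (basis_vec b)) = scale (chi t (c + 1) b) u"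
proof -
  obtain n r i j where b: "b = (n, r, i, j)" by (cases b)
  show ?thesis
  proof (cases n)
    case 0
    then show ?thesis by (auto simp: b step_left_def lie_left_mono chi_def)
  next
    case (Suc m)
    have "chi t c (n, r, i, j) + t * of_nat n * chi t c (m, r + 1, i, j) = chi t (c + 1) (n, r, i, j)"
      using arg_cong[OF falling_factorial_step[where x = "of_int c" and m = m], of "(*) (t ^ n)"]
      by (auto simp: chi_def Suc algebra_simps simp del: prod.lessThan_Suc)
    moreover have "chi t c (n, r, False, True) = 0" by (simp add: chi_def)
    ultimately show ?thesis
      by (auto simp: b step_left_def lie_left_mono Suc cvec.scale_left_distrib[symmetric] mult.assoc)
  qed
qed

lemma chi_step_right:
  "lin (\<lambda>b. scale (chi t c b) u) (step_right t (basis_vec b)) = scale (chi t (c + 1) b) u"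
proof -
  obtain n r i j where b: "b = (n, r, i, j)" by (cases b)
  show ?thesis
  proof (cases n)
    case 0
    then show ?thesis by (auto simp: b step_right_def lie_right_mono chi_def)
  next
    case (Suc m)
    have "chi t c (n, r, i, j) + t * of_nat n * chi t c (m, r, i, j) = chi t (c + 1) (n, r, i, j)"
      using arg_cong[OF falling_factorial_step[where x = "of_int c" and m = m], of "(*) (t ^ n)"]
      by (auto simp: chi_def Suc algebra_simps simp del: prod.lessThan_Suc)
    then show ?thesis
      by (simp add: b step_right_def lie_right_mono Suc cvec.scale_left_distrib[symmetric] mult.assoc)
  qed
qed

lemma form_cop_step_left: "form_cop (step_left t a) = tensor_map (step_left t) id (form_cop a)"
proof -
  have "tensor_map (step_left t) id x = x + scale t (tensor_map lie_left id x)" for x :: "(mono \<times> mono) cvec"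
    by (induction x rule: cvec_induct)
      (auto simp: step_left_def cvec.scale_right_distrib algebra_simps)
  then show ?thesis by (simp add: step_left_def form_cop_lie_left)
qed

lemma form_cop_step_right: "form_cop (step_right t a) = tensor_map id (step_right t) (form_cop a)"
proof -
  have "tensor_map id (step_right t) x = x + scale t (tensor_map id lie_right x)" for x :: "(mono \<times> mono) cvec"
    by (induction x rule: cvec_induct)
      (auto simp: step_right_def cvec.scale_right_distrib algebra_simps)
  then show ?thesis by (simp add: step_right_def form_cop_lie_right)
qed

lemma form_cop_step_middle: "tensor_map (step_right t) id (form_cop a) = tensor_map id (step_left t) (form_cop a)"
proof -
  have "tensor_map id (step_left t) x = x + scale t (tensor_map id lie_left x)"
    "tensor_map (step_right t) id x = x + scale t (tensor_map lie_right id x)" for x :: "(mono \<times> mono) cvec"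
    by (induction x rule: cvec_induct;
      auto simp: step_right_def step_left_def cvec.scale_right_distrib algebra_simps)+
  then show ?thesis by (simp add: form_cop_lie_middle)
qed

lemma lin_tensor_map: "lin (\<lambda>(b, c). F b c) (tensor_map f h x)
    = lin (\<lambda>(b, c). lin (\<lambda>b'. lin (\<lambda>c'. F b' c') (h (basis_vec c))) (f (basis_vec b))) x"
  by (induction x rule: cvec_induct) (auto simp: lin_tensor)

lemma shift_left_step: "shift_left t c (step_left t a) = shift_left t (c + 1) a"
proof -
  have "lin (\<lambda>(b, u). scale (chi t c b) (basis_vec u)) (tensor_map (step_left t) id x)
      = lin (\<lambda>(b, u). scale (chi t (c + 1) b) (basis_vec u)) x" for x :: "(mono \<times> mono) cvec"
    by (induction x rule: cvec_induct)
      (auto simp: lin_tensor chi_step_left)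
  then show ?thesis by (simp add: shift_left_def form_cop_step_left)
qed

lemma shift_right_step: "shift_right t c (step_right t a) = shift_right t (c + 1) a"
proof -
  have "lin (\<lambda>(u, b). scale (chi t c b) (basis_vec u)) (tensor_map id (step_right t) x)
      = lin (\<lambda>(u, b). scale (chi t (c + 1) b) (basis_vec u)) x" for x :: "(mono \<times> mono) cvec"
    by (induction x rule: cvec_induct)
      (auto simp: lin_tensor chi_step_right)
  then show ?thesis by (simp add: shift_right_def form_cop_step_right)
qed

lemma step_shift_left: "step_left t (shift_left t c a) = shift_left t (c + 1) a"
proof -
  have lin: "linear_map (step_left t)" by (rule linear_mapI) simp_all
  have "step_left t (shift_left t c a) = lin (\<lambda>(b, u). scale (chi t c b) (step_left t (basis_vec u))) (form_cop a)"
    by (simp add: shift_left_def linear_lin_eq[OF lin] case_prod_unfold)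
  also have "\<dots> = lin (\<lambda>(b, u). scale (chi t c b) (basis_vec u)) (tensor_map id (step_left t) (form_cop a))"
    by (simp add: lin_tensor_map lin_scale_fun)
  also have "\<dots> = lin (\<lambda>(b, u). scale (chi t c b) (basis_vec u)) (tensor_map (step_right t) id (form_cop a))"
    by (simp add: form_cop_step_middle)
  also have "\<dots> = shift_left t (c + 1) a"
    by (simp add: lin_tensor_map shift_left_def lin_scale_fun chi_step_right)
  finally show ?thesis .
qed

lemma step_shift_right: "step_right t (shift_right t c a) = shift_right t (c + 1) a"
proof -
  have lin: "linear_map (step_right t)" by (rule linear_mapI) simp_all
  have "step_right t (shift_right t c a) = lin (\<lambda>(u, b). scale (chi t c b) (step_right t (basis_vec u))) (form_cop a)"
    by (simp add: shift_right_def linear_lin_eq[OF lin] case_prod_unfold)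
  also have "\<dots> = lin (\<lambda>(u, b). scale (chi t c b) (basis_vec u)) (tensor_map (step_right t) id (form_cop a))"
    by (simp add: lin_tensor_map lin_scale_fun)
  also have "\<dots> = lin (\<lambda>(u, b). scale (chi t c b) (basis_vec u)) (tensor_map id (step_left t) (form_cop a))"
    by (simp add: form_cop_step_middle)
  also have "\<dots> = shift_right t (c + 1) a"
    by (simp add: lin_tensor_map shift_right_def lin_scale_fun chi_step_left)
  finally show ?thesis .
qed

interpretation shift_left: int_flow "step_left t" "shift_left t" for t
proof
  show "shift_left t 0 v = v" for v
    by (simp add: shift_left_def chi_zero form_counit_left)
qed (simp_all add: shift_left_step step_shift_left)

interpretation shift_right: int_flow "step_right t" "shift_right t" for t
proof
  show "shift_right t 0 v = v" for v
    by (simp add: shift_right_def chi_zero form_counit_right)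
qed (simp_all add: shift_right_step step_shift_right)

lemma shift_left_degree: "a \<in> forms k \<Longrightarrow> shift_left t c a \<in> forms k"
proof (induction a rule: homogeneous_induct)
  case (basis b)
  then show ?case
    unfolding shift_left_def
    by (intro homogeneous_lin) (auto simp: chi_def dest!: form_cop_keyD(4))
qed simp_all

lemma shift_right_degree: "a \<in> forms k \<Longrightarrow> shift_right t c a \<in> forms k"
proof (induction a rule: homogeneous_induct)
  case (basis b)
  then show ?case
    unfolding shift_right_def
    by (intro homogeneous_lin) (auto simp: chi_def dest!: form_cop_keyD(4))
qed simp_all

text \<open>
  The shifts inherit the behaviour of the two derivations on the legs of the coproduct, now as direct
  instances of coassociativity.
\<close>

lemma form_cop_shift_left: "form_cop (shift_left t c a) = tensor_map (shift_left t c) id (form_cop a)"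
proof -
  have "form_cop (shift_left t c a)
      = lin (\<lambda>(b, u). lin (\<lambda>(x, y). scale (chi t c b) (basis_vec (x, y))) (form_cop (basis_vec u))) (form_cop a)"
    unfolding shift_left_def linear_lin_eq[OF linear_form_cop]
    by (simp add: case_prod_unfold lin_scale_fun)
  also have "\<dots> = lin (\<lambda>(u, y). lin (\<lambda>(b, x). scale (chi t c b) (basis_vec (x, y))) (form_cop (basis_vec u))) (form_cop a)"
    by (rule form_coassoc_lin[symmetric])
  also have "\<dots> = tensor_map (shift_left t c) id (form_cop a)"
    unfolding tensor_map_def shift_left_def
    by (simp add: case_prod_unfold linear_lin_eq[OF linear_tensor_left])
  finally show ?thesis .
qed

lemma form_cop_shift_right: "form_cop (shift_right t c a) = tensor_map id (shift_right t c) (form_cop a)"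
proof -
  have "form_cop (shift_right t c a)
      = lin (\<lambda>(u, b). lin (\<lambda>(x, y). scale (chi t c b) (basis_vec (x, y))) (form_cop (basis_vec u))) (form_cop a)"
    unfolding shift_right_def linear_lin_eq[OF linear_form_cop]
    by (simp add: case_prod_unfold lin_scale_fun)
  also have "\<dots> = lin (\<lambda>(x, u). lin (\<lambda>(y, b). scale (chi t c b) (basis_vec (x, y))) (form_cop (basis_vec u))) (form_cop a)"
    by (rule form_coassoc_lin)
  also have "\<dots> = tensor_map id (shift_right t c) (form_cop a)"
    unfolding tensor_map_def shift_right_def
    by (simp add: case_prod_unfold linear_lin_eq[OF linear_tensor_right])
  finally show ?thesis .
qed

lemma form_cop_shift_middle:
  "tensor_map (shift_right t c) id (form_cop a) = tensor_map id (shift_left t c) (form_cop a)"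
proof -
  have "tensor_map (shift_right t c) id (form_cop a)
      = lin (\<lambda>(u, y). lin (\<lambda>(x, b). scale (chi t c b) (basis_vec (x, y))) (form_cop (basis_vec u))) (form_cop a)"
    unfolding tensor_map_def shift_right_def
    by (simp add: case_prod_unfold linear_lin_eq[OF linear_tensor_left])
  also have "\<dots> = lin (\<lambda>(x, u). lin (\<lambda>(b, y). scale (chi t c b) (basis_vec (x, y))) (form_cop (basis_vec u))) (form_cop a)"
    by (rule form_coassoc_lin)
  also have "\<dots> = tensor_map id (shift_left t c) (form_cop a)"
    unfolding tensor_map_def shift_left_def
    by (simp add: case_prod_unfold linear_lin_eq[OF linear_tensor_right])
  finally show ?thesis .
qed

lemma step_left_step_right: "step_left t (step_right s a) = step_right s (step_left t a)"
  by (simp add: step_left_def step_right_def lie_left_lie_right cvec.scale_right_distrib algebra_simps)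

lemma shift_left_shift_right: "shift_left t c (shift_right s e a) = shift_right s e (shift_left t c a)"
proof (rule shift_right.flow_commute)
  fix v
  show "shift_left t c (step_right s v) = step_right s (shift_left t c v)"
    by (rule shift_left.flow_commute[symmetric]) (simp add: step_left_step_right)
qed

lemma ext_d_shift_left: "ext_d (shift_left t c a) = shift_left t c (ext_d a)"
  by (rule shift_left.flow_commute) (simp add: step_left_def ext_d_lie_left)

lemma ext_d_shift_right: "ext_d (shift_right t c a) = shift_right t c (ext_d a)"
  by (rule shift_right.flow_commute) (simp add: step_right_def ext_d_lie_right)

section \<open>The twisted product\<close>

lemma degree0_part_basis [simp]: "degree0_part (basis_vec b) = (if form_degree b = 0 then basis_vec b else 0)"
  by (simp add: degree0_part_def)

text \<open>
  As far as expressions vanishing for outer legs of positive degree are concerned, the bicoaction is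
  the iterated coproduct.
\<close>

lemma bicoaction_lin:
  assumes "\<And>a b c. form_degree a \<noteq> 0 \<or> form_degree c \<noteq> 0 \<Longrightarrow> F a b c = 0"
  shows "lin (\<lambda>(a, b, c). F a b c) (bicoaction \<alpha>)
    = lin (\<lambda>(u, c). lin (\<lambda>(a, b). F a b c) (form_cop (basis_vec u))) (form_cop \<alpha>)"
proof -
  have *: "lin (\<lambda>(a, b). F a b c) (coact_left (basis_vec u)) = lin (\<lambda>(a, b). F a b c) (form_cop (basis_vec u))"
    for u c
    unfolding coact_left_def lin_tensor_map
    by (rule lin_cong_keys) (auto simp: assms)
  show ?thesis
    unfolding bicoaction_def lin_tensor_assoc_map coact_right_def lin_tensor_map *
    by (rule lin_cong_keys) (auto simp: assms)
qed

text \<open>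
  Both cocycle values only see the second argument through its counit and a weight, where for
  \<open>b = g\<^sup>s\<close> the two weights are \<open>s\<close>.
\<close>

lemma cocycle_eq: "cocycle A a b = form_counit (basis_vec b) * chi (\<i> * A) (- wt_left b) a"
  by (cases a; cases b) (auto simp: cocycle_def chi_def)

lemma cocycle_inv_eq: "cocycle_inv A a b = form_counit (basis_vec b) * chi (\<i> * A) (wt_right b) a"
  by (cases a; cases b) (auto simp: cocycle_inv_def chi_def)

lemma chi_degree: "form_degree b \<noteq> 0 \<Longrightarrow> chi t c b = 0"
  by (cases b) (auto simp: chi_def split: if_splits)

lemma form_counit_degree: "form_degree b \<noteq> 0 \<Longrightarrow> form_counit (basis_vec b) = 0"
  by (cases b) (auto split: if_splits)

text \<open>
  The operator \<open>X\<^sup>-\<^sup>l Y\<^sup>r\<close>, by which the twist by a factor of weights \<open>(l, r)\<close> acts on the other factor.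
\<close>

definition twist_op :: "complex \<Rightarrow> int \<Rightarrow> int \<Rightarrow> form \<Rightarrow> form" where
  "twist_op A l r a = shift_left (\<i> * A) (- l) (shift_right (\<i> * A) r a)"

lemma twist_op_linear [simp]:
  "twist_op A l r (a + b) = twist_op A l r a + twist_op A l r b"
  "twist_op A l r (scale c a) = scale c (twist_op A l r a)"
  "twist_op A l r 0 = 0" "twist_op A l r (- a) = - twist_op A l r a"
  by (simp_all add: twist_op_def)

text \<open>
  The twisted product is the classical one after a twist of the left factor.
\<close>

lemma twisted_mult_basis:
  "\<alpha> \<bullet>\<^bsub>A\<^esub> basis_vec b = twist_op A (wt_left b) (wt_right b) \<alpha> \<curlywedge> basis_vec b"
proof -
  let ?t = "\<i> * A"
  let ?l = "- wt_left b" and ?r = "wt_right b"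
  have right: "lin (\<lambda>(b1, b2, b3). scale (cocycle A a1 b1 * cocycle_inv A a3 b3) (basis_vec a2 \<curlywedge> basis_vec b2))
      (bicoaction (basis_vec b)) = scale (chi ?t ?l a1 * chi ?t ?r a3) (basis_vec a2 \<curlywedge> basis_vec b)"
    for a1 a2 a3
  proof -
    have "lin (\<lambda>(b1, b2, b3). scale (cocycle A a1 b1 * cocycle_inv A a3 b3) (basis_vec a2 \<curlywedge> basis_vec b2))
        (bicoaction (basis_vec b))
      = lin (\<lambda>(u, b3). lin (\<lambda>(b1, b2). scale (cocycle A a1 b1 * cocycle_inv A a3 b3)
          (basis_vec a2 \<curlywedge> basis_vec b2)) (form_cop (basis_vec u))) (form_cop (basis_vec b))"
      by (rule bicoaction_lin) (auto simp: cocycle_eq cocycle_inv_eq form_counit_degree)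
    also have "\<dots> = lin (\<lambda>(u, b3). scale (chi ?t ?l a1 * chi ?t ?r a3) (basis_vec a2 \<curlywedge>
         scale (form_counit (basis_vec b3)) (basis_vec u))) (form_cop (basis_vec b))"
    proof (rule lin_cong_keys, clarify)
      fix u b3 assume "(u, b3) \<in> Poly_Mapping.keys (form_cop (basis_vec b))"
      note ub = form_cop_keyD[OF this]
      have "lin (\<lambda>(b1, b2). scale (cocycle A a1 b1 * cocycle_inv A a3 b3)
          (basis_vec a2 \<curlywedge> basis_vec b2)) (form_cop (basis_vec u))
        = lin (\<lambda>(b1, b2). scale (chi ?t ?l a1 * chi ?t ?r a3 * form_counit (basis_vec b3))
          (basis_vec a2 \<curlywedge> scale (form_counit (basis_vec b1)) (basis_vec b2))) (form_cop (basis_vec u))"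
        by (rule lin_cong_keys)
          (auto simp: cocycle_eq cocycle_inv_eq ub algebra_simps dest!: form_cop_keyD(1))
      also have "\<dots> = scale (chi ?t ?l a1 * chi ?t ?r a3 * form_counit (basis_vec b3)) (basis_vec a2 \<curlywedge>
          lin (\<lambda>(b1, b2). scale (form_counit (basis_vec b1)) (basis_vec b2)) (form_cop (basis_vec u)))"
        unfolding linear_lin_eq[OF linear_wedge(2)] lin_scale_fun[symmetric]
        by (simp add: case_prod_unfold)
      finally show "lin (\<lambda>(b1, b2). scale (cocycle A a1 b1 * cocycle_inv A a3 b3)
          (basis_vec a2 \<curlywedge> basis_vec b2)) (form_cop (basis_vec u))
        = scale (chi ?t ?l a1 * chi ?t ?r a3) (basis_vec a2 \<curlywedge> scale (form_counit (basis_vec b3)) (basis_vec u))"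
        by (simp add: form_counit_left)
    qed
    also have "\<dots> = scale (chi ?t ?l a1 * chi ?t ?r a3) (basis_vec a2 \<curlywedge>
        lin (\<lambda>(u, b3). scale (form_counit (basis_vec b3)) (basis_vec u)) (form_cop (basis_vec b)))"
      unfolding linear_lin_eq[OF linear_wedge(2)] lin_scale_fun[symmetric]
      by (simp add: case_prod_unfold)
    finally show ?thesis by (simp add: form_counit_right)
  qed
  have "\<alpha> \<bullet>\<^bsub>A\<^esub> basis_vec b = lin (\<lambda>(a1, a2, a3). scale (chi ?t ?l a1 * chi ?t ?r a3)
      (basis_vec a2 \<curlywedge> basis_vec b)) (bicoaction \<alpha>)"
    unfolding twisted_mult_def bilin_def
    by (rule lin_cong_keys) (clarsimp simp: right)
  also have "\<dots> = lin (\<lambda>(u, a3). lin (\<lambda>(a1, a2). scale (chi ?t ?l a1 * chi ?t ?r a3)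
      (basis_vec a2 \<curlywedge> basis_vec b)) (form_cop (basis_vec u))) (form_cop \<alpha>)"
    by (rule bicoaction_lin) (auto simp: chi_degree)
  also have "\<dots> = lin (\<lambda>(u, a3). scale (chi ?t ?r a3) (shift_left ?t ?l (basis_vec u))) (form_cop \<alpha>) \<curlywedge> basis_vec b"
    unfolding shift_left_def linear_lin_eq[OF linear_wedge(1)] lin_scale_fun[symmetric]
    by (simp add: case_prod_unfold linear_lin_eq[OF linear_wedge(1)] mult.commute lin_scale_fun[symmetric])
  also have "\<dots> = twist_op A (wt_left b) ?r \<alpha> \<curlywedge> basis_vec b"
    unfolding twist_op_def shift_right_def linear_lin_eq[OF linear_shift_left]
    by (simp add: case_prod_unfold)
  finally show ?thesis .
qed

lemma twisted_mult_linear [simp]: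
  "(u + u') \<bullet>\<^bsub>A\<^esub> v = u \<bullet>\<^bsub>A\<^esub> v + u' \<bullet>\<^bsub>A\<^esub> v"
  "scale c u \<bullet>\<^bsub>A\<^esub> v = scale c (u \<bullet>\<^bsub>A\<^esub> v)"
  "u \<bullet>\<^bsub>A\<^esub> (v + v') = u \<bullet>\<^bsub>A\<^esub> v + u \<bullet>\<^bsub>A\<^esub> v'"
  "u \<bullet>\<^bsub>A\<^esub> scale c v = scale c (u \<bullet>\<^bsub>A\<^esub> v)"
  "0 \<bullet>\<^bsub>A\<^esub> v = 0" "u \<bullet>\<^bsub>A\<^esub> 0 = 0"
proof -
  have "linear_map bicoaction"
    unfolding bicoaction_def coact_right_def
    by (intro linear_compose[OF linear_tensor_assoc] linear_compose[OF linear_tensor_map] linear_form_cop)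
  then have [simp]: "bicoaction (u + v) = bicoaction u + bicoaction v"
    "bicoaction (scale c u) = scale c (bicoaction u)" "bicoaction 0 = 0" for u v c
    by (simp_all add: linear_map_add linear_map_scale linear_map_zero)
  show "(u + u') \<bullet>\<^bsub>A\<^esub> v = u \<bullet>\<^bsub>A\<^esub> v + u' \<bullet>\<^bsub>A\<^esub> v"
    "scale c u \<bullet>\<^bsub>A\<^esub> v = scale c (u \<bullet>\<^bsub>A\<^esub> v)"
    "u \<bullet>\<^bsub>A\<^esub> (v + v') = u \<bullet>\<^bsub>A\<^esub> v + u \<bullet>\<^bsub>A\<^esub> v'"
    "u \<bullet>\<^bsub>A\<^esub> scale c v = scale c (u \<bullet>\<^bsub>A\<^esub> v)"
    "0 \<bullet>\<^bsub>A\<^esub> v = 0" "u \<bullet>\<^bsub>A\<^esub> 0 = 0"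
    by (simp_all add: twisted_mult_def)
qed

lemma twisted_mult_weight:
  assumes "Poly_Mapping.keys \<beta> \<subseteq> {b. wt_left b = l \<and> wt_right b = r}"
  shows "\<alpha> \<bullet>\<^bsub>A\<^esub> \<beta> = twist_op A l r \<alpha> \<curlywedge> \<beta>"
  using assms by (induction \<beta> rule: supported_induct) (auto simp: twisted_mult_basis)

lemma twist_op_0 [simp]: "twist_op A 0 0 a = a"
  by (simp add: twist_op_def shift_left.flow_0 shift_right.flow_0)

lemma twist_op_add: "twist_op A l r (twist_op A l' r' a) = twist_op A (l + l') (r + r') a"
  by (simp add: twist_op_def shift_left_shift_right shift_left.flow_add shift_right.flow_add)

lemma twist_op_degree: "a \<in> forms k \<Longrightarrow> twist_op A l r a \<in> forms k"
  by (simp add: twist_op_def shift_left_degree shift_right_degree)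

lemma ext_d_twist_op: "ext_d (twist_op A l r a) = twist_op A l r (ext_d a)"
  by (simp add: twist_op_def ext_d_shift_left ext_d_shift_right)

lemma keys_lie_left:
  "Poly_Mapping.keys (lie_left (basis_vec b)) \<subseteq> {c. wt_left c = wt_left b + 1 \<and> wt_right c = wt_right b}"
proof -
  obtain n r i j where b: "b = (n, r, i, j)" by (cases b)
  show ?thesis
    unfolding b lie_left_mono
    by (intro keys_add_subset; cases n) (auto simp: in_keys_iff lookup_single when_def split: if_splits)
qed

lemma keys_lie_right:
  "Poly_Mapping.keys (lie_right (basis_vec b)) \<subseteq> {c. wt_left c = wt_left b \<and> wt_right c = wt_right b - 1}"
proof -
  obtain n r i j where b: "b = (n, r, i, j)" by (cases b)
  show ?thesis
    unfolding b lie_right_mono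
    by (cases n) (auto simp: in_keys_iff lookup_single when_def split: if_splits)
qed

lemma keys_ext_d:
  "Poly_Mapping.keys (ext_d (basis_vec b)) \<subseteq> {c. wt_left c = wt_left b \<and> wt_right c = wt_right b}"
proof -
  obtain n r i j where b: "b = (n, r, i, j)" by (cases b)
  show ?thesis
    unfolding b ext_d_mono
    by (intro keys_add_subset; cases n) (auto simp: in_keys_iff lookup_single when_def split: if_splits)
qed

lemma twist_op_step_left:
  "twist_op A l r (step_left (\<i> * A) a) = step_left (\<i> * A) (twist_op A l r a)"
  "twist_op A (l + 1) r (step_left (\<i> * A) a) = twist_op A l r a"
proof -
  have "shift_right (\<i> * A) r (step_left (\<i> * A) a) = step_left (\<i> * A) (shift_right (\<i> * A) r a)"
    by (rule shift_right.flow_commute[symmetric]) (simp add: step_left_step_right)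
  moreover have "- (l + 1) + 1 = - l" by simp
  ultimately show "twist_op A l r (step_left (\<i> * A) a) = step_left (\<i> * A) (twist_op A l r a)"
    "twist_op A (l + 1) r (step_left (\<i> * A) a) = twist_op A l r a"
    by (simp_all only: twist_op_def shift_left_step step_shift_left)
qed

lemma twist_op_step_right:
  "twist_op A l r (step_right (\<i> * A) a) = step_right (\<i> * A) (twist_op A l r a)"
  "twist_op A l (r - 1) (step_right (\<i> * A) a) = twist_op A l r a"
proof -
  have "step_right (\<i> * A) (shift_left (\<i> * A) (- l) a) = shift_left (\<i> * A) (- l) (step_right (\<i> * A) a)" for a
    by (rule shift_left.flow_commute) (simp add: step_left_step_right)
  moreover have "r - 1 + 1 = r" by simp
  ultimately show "twist_op A l r (step_right (\<i> * A) a) = step_right (\<i> * A) (twist_op A l r a)"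
    "twist_op A l (r - 1) (step_right (\<i> * A) a) = twist_op A l r a"
    by (simp_all only: twist_op_def shift_right_step step_shift_right)
qed

text \<open>
  In \<open>X (u \<and> b) = X u \<and> b + u \<and> t E\<^sub>L b\<close> with \<open>u = X\<^sup>-\<^sup>l Y\<^sup>r a\<close>, the form \<open>E\<^sub>L b\<close> has left weight \<open>l + 1\<close>, so that
  \<open>u \<and> t E\<^sub>L b = X a \<bullet> t E\<^sub>L b\<close>.
\<close>

lemma step_left_twisted_mult:
  "step_left (\<i> * A) (a \<bullet>\<^bsub>A\<^esub> b) = step_left (\<i> * A) a \<bullet>\<^bsub>A\<^esub> step_left (\<i> * A) b"
proof (induction b rule: cvec_induct)
  case (basis b)
  let ?t = "\<i> * A" and ?u = "twist_op A (wt_left b) (wt_right b) a"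
  have "step_left ?t (a \<bullet>\<^bsub>A\<^esub> basis_vec b) = step_left ?t ?u \<curlywedge> basis_vec b + ?u \<curlywedge> scale ?t (lie_left (basis_vec b))"
    by (simp add: twisted_mult_basis step_left_def lie_left_wedge cvec.scale_right_distrib)
  also have "\<dots> = step_left ?t a \<bullet>\<^bsub>A\<^esub> basis_vec b + step_left ?t a \<bullet>\<^bsub>A\<^esub> scale ?t (lie_left (basis_vec b))"
    using twisted_mult_weight[OF keys_lie_left[of b], where \<alpha> = "step_left ?t a" and A = A,
        unfolded twist_op_step_left(2)]
    by (simp add: twisted_mult_basis twist_op_step_left(1))
  finally show ?case by (simp add: step_left_def)
qed simp_all

lemma step_right_twisted_mult:
  "step_right (\<i> * A) (a \<bullet>\<^bsub>A\<^esub> b) = step_right (\<i> * A) a \<bullet>\<^bsub>A\<^esub> step_right (\<i> * A) b"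
proof (induction b rule: cvec_induct)
  case (basis b)
  let ?t = "\<i> * A" and ?u = "twist_op A (wt_left b) (wt_right b) a"
  have "step_right ?t (a \<bullet>\<^bsub>A\<^esub> basis_vec b) = step_right ?t ?u \<curlywedge> basis_vec b + ?u \<curlywedge> scale ?t (lie_right (basis_vec b))"
    by (simp add: twisted_mult_basis step_right_def lie_right_wedge cvec.scale_right_distrib)
  also have "\<dots> = step_right ?t a \<bullet>\<^bsub>A\<^esub> basis_vec b + step_right ?t a \<bullet>\<^bsub>A\<^esub> scale ?t (lie_right (basis_vec b))"
    using twisted_mult_weight[OF keys_lie_right[of b], where \<alpha> = "step_right ?t a" and A = A,
        unfolded twist_op_step_right(2)]
    by (simp add: twisted_mult_basis twist_op_step_right(1))
  finally show ?case by (simp add: step_right_def)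
qed simp_all

lemma twist_op_mult: "twist_op A l r (a \<bullet>\<^bsub>A\<^esub> b) = twist_op A l r a \<bullet>\<^bsub>A\<^esub> twist_op A l r b"
  by (simp add: twist_op_def shift_left.flow_mult[where m = "twisted_mult A" and t = "\<i> * A", OF step_left_twisted_mult]
      shift_right.flow_mult[where m = "twisted_mult A" and t = "\<i> * A", OF step_right_twisted_mult])

lemma twisted_mult_wedge_basis:
  "a \<bullet>\<^bsub>A\<^esub> (v \<curlywedge> basis_vec c) = (twist_op A (wt_left c) (wt_right c) a \<bullet>\<^bsub>A\<^esub> v) \<curlywedge> basis_vec c"
proof (induction v rule: cvec_induct)
  case (basis b)
  have "Poly_Mapping.keys (basis_vec b \<curlywedge> basis_vec c)
      \<subseteq> {d. wt_left d = wt_left b + wt_left c \<and> wt_right d = wt_right b + wt_right c}"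
    using keys_wedge_basis by blast
  from twisted_mult_weight[OF this] show ?case
    by (simp add: twisted_mult_basis twist_op_add wedge_assoc)
qed simp_all

lemma twisted_mult_assoc: "(a \<bullet>\<^bsub>A\<^esub> b) \<bullet>\<^bsub>A\<^esub> c = a \<bullet>\<^bsub>A\<^esub> (b \<bullet>\<^bsub>A\<^esub> c)"
  by (induction c rule: cvec_induct) (simp_all add: twisted_mult_basis twist_op_mult twisted_mult_wedge_basis)

lemma lie_one [simp]: "lie_left one_form = 0" "lie_right one_form = 0"
  by (simp_all add: one_form_def lie_left_mono lie_right_mono)

lemma shift_left_fixed: "lie_left a = 0 \<Longrightarrow> shift_left t c a = a"
  by (rule shift_left.flow_commute[of "\<lambda>_. a", symmetric]) (simp add: step_left_def)

lemma shift_right_fixed: "lie_right a = 0 \<Longrightarrow> shift_right t c a = a"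
  by (rule shift_right.flow_commute[of "\<lambda>_. a", symmetric]) (simp add: step_right_def)

lemma twist_op_one [simp]: "twist_op A l r one_form = one_form"
  by (simp add: twist_op_def shift_left_fixed shift_right_fixed)

lemma twisted_mult_one [simp]: "a \<bullet>\<^bsub>A\<^esub> one_form = a" "one_form \<bullet>\<^bsub>A\<^esub> a = a"
proof -
  show "a \<bullet>\<^bsub>A\<^esub> one_form = a"
    using twisted_mult_basis[where \<alpha> = a and A = A and b = "(0, 0, False, False)"] by (simp add: one_form_def[symmetric])
  show "one_form \<bullet>\<^bsub>A\<^esub> a = a"
    by (induction a rule: cvec_induct) (simp_all add: twisted_mult_basis)
qed

lemma twisted_mult_degree: 
  assumes "a \<in> forms k" "b \<in> forms l"
  shows "a \<bullet>\<^bsub>A\<^esub> b \<in> forms (k + l)"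
  using assms(2)
proof (induction b rule: homogeneous_induct)
  case (basis b)
  then show ?case
    unfolding twisted_mult_basis by (intro wedge.mul_degree twist_op_degree assms) simp
qed simp_all

lemma twisted_graded_algebra: "graded_algebra form_degree (twisted_mult A) one_form"
proof
  show "one_form \<in> forms 0" by (simp add: one_form_def)
qed (auto intro: linear_mapI twisted_mult_degree simp: twisted_mult_assoc)

interpretation twisted: graded_algebra form_degree "twisted_mult A" one_form for A
  by (rule twisted_graded_algebra)

lemma twisted_Leibniz:
  assumes "a \<in> forms k"
  shows "ext_d (a \<bullet>\<^bsub>A\<^esub> b) = ext_d a \<bullet>\<^bsub>A\<^esub> b + scale ((-1) ^ k) (a \<bullet>\<^bsub>A\<^esub> ext_d b)"
proof (induction b rule: cvec_induct)
  case (basis b)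
  show ?case
    using twisted_mult_weight[OF keys_ext_d[of b], where \<alpha> = a and A = A]
    by (simp add: twisted_mult_basis ext_d_Leibniz[OF twist_op_degree[OF assms]] ext_d_twist_op)
qed (simp_all add: cvec.scale_right_distrib algebra_simps)

lemma wedge_basis_eq_twisted:
  "a \<curlywedge> basis_vec b = twist_op A (- wt_left b) (- wt_right b) a \<bullet>\<^bsub>A\<^esub> basis_vec b"
  by (simp add: twisted_mult_basis twist_op_add)

text \<open>
  Every classical product with \<open>dp\<close> or \<open>dg\<close> is also a twisted one, since the twist of the left factor is
  invertible.
\<close>

lemma twisted_generated:
  assumes V: "cvec.subspace V" and V0: "forms 0 \<subseteq> V" and dV0: "ext_d ` forms 0 \<subseteq> V"
    and mult: "\<And>a b. a \<in> V \<Longrightarrow> b \<in> V \<Longrightarrow> a \<bullet>\<^bsub>A\<^esub> b \<in> V"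
  shows "V = UNIV"
proof -
  have d: "ext_d a \<in> V" if "a \<in> forms 0" for a
    using dV0 that by blast
  have dp: "gen_dp \<in> V" and dg: "gen_dg \<in> V"
    using d[of gen_p] d[of gen_g] by (simp_all add: gen_p_def gen_g_def ext_d_mono)
  have wedge_V: "a \<curlywedge> gen_dp \<in> V" "a \<curlywedge> gen_dg \<in> V" if "a \<in> forms k" "forms k \<subseteq> V" for a k
  proof -
    have "twist_op A l r a \<in> V" for l r
      using twist_op_degree[OF that(1)] that(2) by (rule rev_subsetD)
    then show "a \<curlywedge> gen_dp \<in> V" "a \<curlywedge> gen_dg \<in> V"
      by (simp_all only: wedge_basis_eq_twisted[of _ _ A] mult dp dg)
  qed
  have 0: "mono_form n r False False \<in> V" for n r
    by (rule subsetD[OF V0]) simp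
  have one: "mono_form n r True False \<in> V" "mono_form n r False True \<in> V" for n r
    using wedge_V[OF _ V0, of "mono_form n r False False"] by (simp_all add: wedge_mono)
  have "forms 1 \<subseteq> V"
  proof
    fix v assume "v \<in> forms 1"
    then show "v \<in> V"
    proof (induction v rule: homogeneous_induct)
      case (basis b)
      obtain n r i j where b: "b = (n, r, i, j)" by (cases b)
      show ?case using basis one unfolding b by (cases i; cases j) simp_all
    qed (simp_all add: cvec.subspace_0[OF V] cvec.subspace_add[OF V] cvec.subspace_scale[OF V])
  qed
  then have "mono_form n r True False \<curlywedge> gen_dg \<in> V" for n r
    by (intro wedge_V(2)[of _ 1]) simp_all
  then have two: "mono_form n r True True \<in> V" for n r
    by (simp add: wedge_mono)
  have "v \<in> V" for v
  proof (induction v rule: cvec_induct)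
    case (basis b)
    obtain n r i j where b: "b = (n, r, i, j)" by (cases b)
    show ?case using 0 one two unfolding b by (cases i; cases j) simp_all
  qed (simp_all add: cvec.subspace_add[OF V] cvec.subspace_scale[OF V])
  then show ?thesis by blast
qed

lemma twisted_exterior_algebra: "exterior_algebra form_degree (twisted_mult A) one_form ext_d"
  by unfold_locales
    (fact linear_map_add[OF linear_ext_d] linear_map_scale[OF linear_ext_d] ext_d_degree ext_d_ext_d
      twisted_Leibniz | rule twisted_generated; assumption)+

section \<open>The twisted super-Hopf algebra\<close>

interpretation twisted2: graded_algebra_pair form_degree "twisted_mult A" one_form
  form_degree "twisted_mult A" one_form for A
  by unfold_locales

text \<open>
  The inner operators \<open>Y\<^sup>m\<close> and \<open>X\<^sup>-\<^sup>m\<close> cancel, and the outer ones pass through the coproduct.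
\<close>

lemma tensor_map_twist_op:
  "tensor_map (twist_op A l m) (twist_op A m r) (form_cop a) = form_cop (twist_op A l r a)"
proof -
  let ?t = "\<i> * A"
  note lin = linear_shift_left linear_shift_right linear_id
  have "tensor_map (twist_op A l m) (twist_op A m r) x
    = tensor_map (shift_left ?t (- l)) (shift_right ?t r)
        (tensor_map id (shift_left ?t (- m)) (tensor_map (shift_right ?t m) id x))" for x :: "(mono \<times> mono) cvec"
    by (induction x rule: cvec_induct)
      (auto simp: twist_op_def tensor_map_tensor lin shift_left_shift_right)
  moreover have "tensor_map id (shift_left ?t (- m)) (tensor_map id (shift_left ?t m) x) = x"
    for x :: "(mono \<times> mono) cvec"
    by (induction x rule: cvec_induct)
      (auto simp: tensor_map_tensor lin shift_left.flow_add shift_left.flow_0)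
  moreover have "tensor_map (shift_left ?t (- l)) (shift_right ?t r) x
      = tensor_map (shift_left ?t (- l)) id (tensor_map id (shift_right ?t r) x)"
    for x :: "(mono \<times> mono) cvec"
    by (induction x rule: cvec_induct)
      (auto simp: tensor_map_tensor lin)
  ultimately show ?thesis
    by (simp only: form_cop_shift_middle form_cop_shift_left form_cop_shift_right twist_op_def)
qed

lemma twisted_tensor_mult_basis:
  "twisted2.tmul A x (basis_vec (b, c))
    = tensor_map (twist_op A (wt_left b) (wt_right b)) (twist_op A (wt_left c) (wt_right c)) x \<curlywedge>\<^sub>2 basis_vec (b, c)"
proof (induction x rule: cvec_induct)
  case (basis x)
  obtain u v where x: "x = (u, v)" by (cases x)
  have "(twist_op A (wt_left b) (wt_right b) (basis_vec u) \<otimes> twist_op A (wt_left c) (wt_right c) (basis_vec v))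
      \<curlywedge>\<^sub>2 (basis_vec b \<otimes> basis_vec c)
    = scale ((-1) ^ (form_degree v * form_degree b)) (basis_vec u \<bullet>\<^bsub>A\<^esub> basis_vec b \<otimes> basis_vec v \<bullet>\<^bsub>A\<^esub> basis_vec c)"
    unfolding twisted_mult_basis by (rule wedge2.tmul_tensor) (simp_all add: twist_op_degree)
  then show ?case by (simp add: x tensor_mult_basis)
qed simp_all

lemma form_cop_twisted_mult: "form_cop (a \<bullet>\<^bsub>A\<^esub> b) = twisted2.tmul A (form_cop a) (form_cop b)"
proof (induction b rule: cvec_induct)
  case (basis d)
  have "twisted2.tmul A (form_cop a) (form_cop (basis_vec d))
    = form_cop (twist_op A (wt_left d) (wt_right d) a) \<curlywedge>\<^sub>2 form_cop (basis_vec d)"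
  proof (rule linear_map_eq_on[OF linear_tensor_mult_right linear_tensor_mult_right])
    fix x assume x: "x \<in> Poly_Mapping.keys (form_cop (basis_vec d))"
    obtain b c where bc: "x = (b, c)" by (cases x)
    from x have *: "wt_left b = wt_left d" "wt_right b = wt_left c" "wt_right c = wt_right d"
      unfolding bc by (auto dest: form_cop_keyD)
    show "twisted2.tmul A (form_cop a) (basis_vec x)
        = form_cop (twist_op A (wt_left d) (wt_right d) a) \<curlywedge>\<^sub>2 basis_vec x"
      by (simp only: bc twisted_tensor_mult_basis * tensor_map_twist_op)
  qed
  then show ?case by (simp add: twisted_mult_basis form_cop_wedge)
qed simp_all

lemma one_form_nonzero: "one_form \<noteq> 0"
  unfolding one_form_def by (metis lookup_single_eq lookup_zero one_neq_zero)

text \<open>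
  After pairing with the counit the left and the right shift agree. The factor \<^const>\<open>one_form\<close> turns the
  counit into a linear map between spaces of forms.
\<close>

lemma form_counit_shift:
  "scale (form_counit (shift_left t c a)) one_form = lin (\<lambda>b. scale (chi t c b) one_form) a"
  "scale (form_counit (shift_right t c a)) one_form = lin (\<lambda>b. scale (chi t c b) one_form) a"
proof -
  have E: "linear_map (\<lambda>v. scale (form_counit v) one_form)"
    by (rule linear_mapI) (simp_all add: cvec.scale_left_distrib)
  have "scale (form_counit (shift_left t c a)) one_form
      = lin (\<lambda>b. scale (chi t c b) one_form)
         (lin (\<lambda>(b, u). scale (form_counit (basis_vec u)) (basis_vec b)) (form_cop a))"
    unfolding shift_left_def linear_lin_eq[OF E] lin_lin
    by (simp add: case_prod_unfold mult.commute)
  then show "scale (form_counit (shift_left t c a)) one_form = lin (\<lambda>b. scale (chi t c b) one_form) a"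
    by (simp add: form_counit_right)
  have "scale (form_counit (shift_right t c a)) one_form
      = lin (\<lambda>b. scale (chi t c b) one_form)
         (lin (\<lambda>(u, b). scale (form_counit (basis_vec u)) (basis_vec b)) (form_cop a))"
    unfolding shift_right_def linear_lin_eq[OF E] lin_lin
    by (simp add: case_prod_unfold mult.commute)
  then show "scale (form_counit (shift_right t c a)) one_form = lin (\<lambda>b. scale (chi t c b) one_form) a"
    by (simp add: form_counit_left)
qed

lemma form_counit_twist_op: "form_counit (twist_op A s s a) = form_counit a"
proof -
  have "form_counit (shift_left t c b) = form_counit (shift_right t c b)" for t c b
    using form_counit_shift[of t c b] one_form_nonzero by (metis cvec.scale_cancel_right)
  then show ?thesis
    by (simp add: twist_op_def shift_right.flow_add shift_right.flow_0)
qed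

lemma form_counit_twisted_mult: "form_counit (a \<bullet>\<^bsub>A\<^esub> b) = form_counit a * form_counit b"
proof (induction b rule: cvec_induct)
  case (basis b)
  obtain n r i j where b: "b = (n, r, i, j)" by (cases b)
  show ?case
    unfolding b by (auto simp: twisted_mult_basis form_counit_wedge form_counit_twist_op)
qed (simp_all add: algebra_simps)

subsection \<open>Convolution and the antipode\<close>

text \<open>
  A grading of the coalgebra of forms with \<open>p\<close>, \<open>dg\<close> in degree 1, \<open>dp\<close> in degree 2, and the grouplike
  elements \<open>g\<^sup>r\<close> in degree 0. It is the difference of the weights plus the form degree, so the coproduct
  respects it because its terms are paths.
\<close>

definition fdeg :: "mono \<Rightarrow> nat" where
  "fdeg = (\<lambda>(n, r, i, j). n + 2 * of_bool i + of_bool j)"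

lemma fdeg_g [simp]: "fdeg (0, r, False, False) = 0"
  by (simp add: fdeg_def)

lemma fdeg_eq: "int (fdeg b) = wt_right b - wt_left b + int (form_degree b)"
  by (cases b) (simp add: fdeg_def)

lemma fdeg_cop: "(b, c) \<in> Poly_Mapping.keys (form_cop (basis_vec a)) \<Longrightarrow> fdeg b + fdeg c = fdeg a"
  using fdeg_eq[of a] fdeg_eq[of b] fdeg_eq[of c] form_cop_keyD[of b c a] by linarith

lemma fdeg_zero: "fdeg c = 0 \<Longrightarrow> basis_vec c = g_pow (wt_right c)"
  by (cases c) (auto simp: fdeg_def)

lemma form_counit_fdeg: "form_counit (basis_vec c) = of_bool (fdeg c = 0)"
  by (cases c) (auto simp: fdeg_def)

text \<open>
  The convolution product of two linear maps from the coalgebra of forms to the twisted algebra, both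
  given by their values on monomials.
\<close>

definition conv :: "complex \<Rightarrow> (mono \<Rightarrow> form) \<Rightarrow> (mono \<Rightarrow> form) \<Rightarrow> mono \<Rightarrow> form" where
  "conv A f h a = lin (\<lambda>(b, c). f b \<bullet>\<^bsub>A\<^esub> h c) (form_cop (basis_vec a))"

text \<open>
  The unit of the convolution product, \<open>\<alpha> \<mapsto> \<epsilon>(\<alpha>) 1\<close>.
\<close>

definition conv_unit :: "mono \<Rightarrow> form" where
  "conv_unit a = scale (form_counit (basis_vec a)) one_form"

lemma linear_twisted_mult: "linear_map (\<lambda>u. u \<bullet>\<^bsub>A\<^esub> v)" "linear_map (\<lambda>v. u \<bullet>\<^bsub>A\<^esub> v)"
  by (rule linear_mapI; simp)+

lemma conv_assoc: "conv A (conv A f h) k = conv A f (conv A h k)"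
proof
  fix a
  have "conv A (conv A f h) k a = lin (\<lambda>(u, c). lin (\<lambda>(x, y). f x \<bullet>\<^bsub>A\<^esub> (h y \<bullet>\<^bsub>A\<^esub> k c))
      (form_cop (basis_vec u))) (form_cop (basis_vec a))"
    unfolding conv_def linear_lin_eq[OF linear_twisted_mult(1)]
    by (simp add: case_prod_unfold twisted_mult_assoc)
  also have "\<dots> = conv A f (conv A h k) a"
    unfolding conv_def linear_lin_eq[OF linear_twisted_mult(2)] form_coassoc_lin
    by (simp add: case_prod_unfold)
  finally show "conv A (conv A f h) k a = conv A f (conv A h k) a" .
qed

lemma conv_unit_left: "conv A conv_unit f = f"
proof
  fix a
  have "conv A conv_unit f a = lin f (lin (\<lambda>(b, c). scale (form_counit (basis_vec b)) (basis_vec c)) (form_cop (basis_vec a)))"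
    unfolding conv_def conv_unit_def lin_lin by (simp add: case_prod_unfold)
  then show "conv A conv_unit f a = f a" by (simp add: form_counit_left)
qed

lemma conv_unit_right: "conv A f conv_unit = f"
proof
  fix a
  have "conv A f conv_unit a = lin f (lin (\<lambda>(b, c). scale (form_counit (basis_vec c)) (basis_vec b)) (form_cop (basis_vec a)))"
    unfolding conv_def conv_unit_def lin_lin by (simp add: case_prod_unfold)
  then show "conv A f conv_unit a = f a" by (simp add: form_counit_right)
qed

lemma conv_diff:
  "conv A (\<lambda>b. f b - f' b) h a = conv A f h a - conv A f' h a"
  "conv A f (\<lambda>b. h b - h' b) a = conv A f h a - conv A f h' a"
proof -
  have *: "lin (\<lambda>(b, c). F b c - F' b c) x = lin (\<lambda>(b, c). F b c) x - lin (\<lambda>(b, c). F' b c) x"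
    for F F' :: "mono \<Rightarrow> mono \<Rightarrow> form" and x
    by (simp add: lin_def case_prod_unfold sum_subtractf cvec.scale_right_diff_distrib)
  show "conv A (\<lambda>b. f b - f' b) h a = conv A f h a - conv A f' h a"
    "conv A f (\<lambda>b. h b - h' b) a = conv A f h a - conv A f h' a"
    by (simp_all add: conv_def *[symmetric])
qed

text \<open>
  Each term of the coproduct of a monomial of positive degree has a leg of smaller degree, where \<open>M\<close>
  vanishes by induction.
\<close>

lemma conv_idempotent_zero:
  assumes idem: "conv A M M = M" and base: "\<And>a. fdeg a = 0 \<Longrightarrow> M a = 0"
  shows "M a = 0"
proof (induction "fdeg a" arbitrary: a rule: less_induct)
  case less
  show ?case
  proof (cases "fdeg a = 0")
    case False
    have "M b \<bullet>\<^bsub>A\<^esub> M c = 0" if "(b, c) \<in> Poly_Mapping.keys (form_cop (basis_vec a))" for b c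
    proof -
      have "fdeg b < fdeg a \<or> fdeg c < fdeg a"
        using fdeg_cop[OF that] False by linarith
      then show ?thesis using less[of b] less[of c] by auto
    qed
    then have "conv A M M a = lin (\<lambda>_. 0) (form_cop (basis_vec a))"
      unfolding conv_def by (intro lin_cong_keys) auto
    then show ?thesis by (simp add: idem)
  qed (rule base)
qed

text \<open>
  In the left antipode identity for a monomial \<open>a\<close> of right weight \<open>r\<close>, the terms \<open>b \<otimes> c\<close> of the coproduct
  in which \<open>b\<close> has the same degree as \<open>a\<close> add up to \<open>a \<otimes> g\<^sup>r\<close>. Solving for \<open>S(a)\<close> gives this recursion.
\<close>

function antipode_basis :: "complex \<Rightarrow> mono \<Rightarrow> form" where
  "antipode_basis A a = (scale (form_counit (basis_vec a)) one_form
     - (\<Sum>x\<in>Poly_Mapping.keys (form_cop (basis_vec a)). if fdeg (fst x) < fdeg a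
          then scale (Poly_Mapping.lookup (form_cop (basis_vec a)) x)
            (antipode_basis A (fst x) \<bullet>\<^bsub>A\<^esub> basis_vec (snd x)) else 0))
     \<bullet>\<^bsub>A\<^esub> g_pow (- wt_right a)"
  by auto
termination
  by (relation "measure (\<lambda>(A, a). fdeg a)") auto

declare antipode_basis.simps [simp del]

lemma antipode_basis_eq:
  "antipode_basis A a = (scale (form_counit (basis_vec a)) one_form
     - lin (\<lambda>(b, c). if fdeg b < fdeg a then antipode_basis A b \<bullet>\<^bsub>A\<^esub> basis_vec c else 0)
         (form_cop (basis_vec a))) \<bullet>\<^bsub>A\<^esub> g_pow (- wt_right a)"
  by (subst antipode_basis.simps)
    (auto simp: lin_def intro!: arg_cong2[of _ _ _ _ "twisted_mult A"] arg_cong2[of _ _ _ _ minus] sum.cong)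

lemma g_pow_mult: "g_pow r \<bullet>\<^bsub>A\<^esub> g_pow s = g_pow (r + s)"
  by (simp add: twisted_mult_basis twist_op_def shift_left_fixed shift_right_fixed
      lie_left_mono lie_right_mono wedge_mono)

lemma antipode_basis_left: "conv A (antipode_basis A) basis_vec = conv_unit"
proof
  fix a
  let ?S = "antipode_basis A"
  let ?R = "lin (\<lambda>(b, c). if fdeg b < fdeg a then ?S b \<bullet>\<^bsub>A\<^esub> basis_vec c else 0) (form_cop (basis_vec a))"
  have "conv A ?S basis_vec a = lin (\<lambda>(b, c). (if fdeg b < fdeg a then ?S b \<bullet>\<^bsub>A\<^esub> basis_vec c else 0)
      + (?S b \<bullet>\<^bsub>A\<^esub> conv_unit c) \<bullet>\<^bsub>A\<^esub> g_pow (wt_right a)) (form_cop (basis_vec a))"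
    unfolding conv_def
  proof (rule lin_cong_keys, clarify)
    fix b c assume bc: "(b, c) \<in> Poly_Mapping.keys (form_cop (basis_vec a))"
    show "?S b \<bullet>\<^bsub>A\<^esub> basis_vec c = (if fdeg b < fdeg a then ?S b \<bullet>\<^bsub>A\<^esub> basis_vec c else 0)
      + (?S b \<bullet>\<^bsub>A\<^esub> conv_unit c) \<bullet>\<^bsub>A\<^esub> g_pow (wt_right a)"
    \<comment> \<open>only the first summand on the right survives if \<open>c\<close> has positive degree, else only the second\<close>
    proof (cases "fdeg c = 0")
      case True
      then have "basis_vec c = g_pow (wt_right a)"
        using fdeg_zero form_cop_keyD(3)[OF bc] by metis
      then show ?thesis
        using fdeg_cop[OF bc] True by (simp add: conv_unit_def form_counit_fdeg)
    next
      case False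
      then show ?thesis
        using fdeg_cop[OF bc] by (simp add: conv_unit_def form_counit_fdeg)
    qed
  qed
  also have "\<dots> = ?R + conv A ?S conv_unit a \<bullet>\<^bsub>A\<^esub> g_pow (wt_right a)"
    unfolding conv_def linear_lin_eq[OF linear_twisted_mult(1)] lin_plus_fun[symmetric]
    by (simp add: case_prod_unfold)
  also have "conv A ?S conv_unit a \<bullet>\<^bsub>A\<^esub> g_pow (wt_right a) = conv_unit a - ?R"
    unfolding conv_unit_right
    by (subst antipode_basis_eq) (simp add: twisted_mult_assoc g_pow_mult conv_unit_def one_form_def[symmetric])
  finally show "conv A ?S basis_vec a = conv_unit a" by simp
qed

lemma antipode_basis_g: "antipode_basis A (0, r, False, False) = g_pow (- r)"
proof -
  have "lin (\<lambda>(b, c). if fdeg b < fdeg (0, r, False, False) then F b c else 0) x = 0" for F x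
    by (simp add: case_prod_unfold)
  then show ?thesis
    by (subst antipode_basis_eq) simp
qed

text \<open>
  \<open>T = id * S\<close> is idempotent because \<open>S * id\<close> is the unit, and so is \<open>\<epsilon> - T\<close>.
\<close>

lemma antipode_basis_right: "conv A basis_vec (antipode_basis A) = conv_unit"
proof -
  let ?S = "antipode_basis A"
  let ?T = "conv A basis_vec ?S"
  let ?M = "\<lambda>a. conv_unit a - ?T a"
  have "conv A ?T ?T = conv A basis_vec (conv A (conv A ?S basis_vec) ?S)"
    by (simp only: conv_assoc)
  then have TT: "conv A ?T ?T = ?T"
    by (simp only: antipode_basis_left conv_unit_left)
  have MM: "conv A ?M ?M = ?M"
    by (rule ext) (simp add: conv_diff conv_unit_left conv_unit_right TT)
  have "?M a = 0" for a
  proof (rule conv_idempotent_zero[where M = ?M, OF MM])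
    fix a assume "fdeg a = 0"
    then obtain r where a: "a = (0, r, False, False)"
      by (cases a) (auto simp: fdeg_def)
    show "?M a = 0"
      by (simp add: a conv_unit_def conv_def cop_g_pow_def antipode_basis_g g_pow_mult one_form_def)
  qed
  then show ?thesis by (intro ext) simp
qed

text \<open>
  The antipode of the twisted exterior algebra, extended linearly from the monomials.
\<close>

definition twisted_antipode :: "complex \<Rightarrow> form \<Rightarrow> form" where
  "twisted_antipode A = lin (antipode_basis A)"

lemma conv_unit_lin: "lin conv_unit a = scale (form_counit a) one_form"
  by (induction a rule: cvec_induct) (simp_all add: conv_unit_def cvec.scale_left_distrib)

lemma conv_lin: "lin (conv A f h) a = lin (\<lambda>(b, c). f b \<bullet>\<^bsub>A\<^esub> h c) (form_cop a)"
  by (induction a rule: cvec_induct) (simp_all add: conv_def)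

lemma antipode_basis_degree: "antipode_basis A a \<in> forms (form_degree a)"
proof (induction "fdeg a" arbitrary: a rule: less_induct)
  case less
  have 1: "scale (form_counit (basis_vec a)) one_form \<in> forms (form_degree a)"
    by (cases "form_degree a = 0") (auto simp: form_counit_degree one_form_def)
  have "antipode_basis A b \<bullet>\<^bsub>A\<^esub> basis_vec c \<in> forms (form_degree a)"
    if "(b, c) \<in> Poly_Mapping.keys (form_cop (basis_vec a))" "fdeg b < fdeg a" for b c
    using twisted_mult_degree[OF less[OF that(2)], of "basis_vec c" "form_degree c"] form_cop_keyD(4)[OF that(1)]
    by simp
  then have "lin (\<lambda>(b, c). if fdeg b < fdeg a then antipode_basis A b \<bullet>\<^bsub>A\<^esub> basis_vec c else 0)
         (form_cop (basis_vec a)) \<in> forms (form_degree a)"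
    by (intro homogeneous_lin) auto
  with 1 have "scale (form_counit (basis_vec a)) one_form
     - lin (\<lambda>(b, c). if fdeg b < fdeg a then antipode_basis A b \<bullet>\<^bsub>A\<^esub> basis_vec c else 0)
         (form_cop (basis_vec a)) \<in> forms (form_degree a)"
    unfolding diff_conv_add_uminus by (intro homogeneous_add homogeneous_uminus)
  from twisted_mult_degree[OF this, of "g_pow (- wt_right a)" 0] show ?case
    by (subst antipode_basis_eq) simp
qed

lemma twisted_super_hopf_algebra:
  "super_hopf_algebra form_degree (twisted_mult A) one_form form_cop form_counit (twisted_antipode A)"
proof (intro super_hopf_algebra.intro super_hopf_algebra_axioms.intro)
  show "graded_algebra form_degree (twisted_mult A) one_form"
    by (rule twisted_graded_algebra)
  fix a b :: form and k
  show "linear_map form_cop" by (rule linear_form_cop)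
  show "Vector_Spaces.linear scale (*) form_counit" by (rule linear_form_counit)
  show "linear_map (twisted_antipode A)"
    by (simp add: twisted_antipode_def linear_lin)
  show "form_cop a \<in> homogeneous degree2 k" if "a \<in> forms k"
    using that by (rule form_cop_degree)
  show "form_counit a = 0" if "a \<in> forms (Suc k)"
    using that
  proof (induction a rule: homogeneous_induct)
    case zero
    show ?case using form_counit_linear(2)[of 0 0] by simp
  qed (simp_all add: form_counit_degree)
  show "twisted_antipode A a \<in> forms k" if "a \<in> forms k"
    unfolding twisted_antipode_def
  proof (rule homogeneous_lin)
    fix b assume "b \<in> Poly_Mapping.keys a"
    then have "form_degree b = k"
      using that by (simp add: homogeneous_def)
    then show "antipode_basis A b \<in> forms k"
      using antipode_basis_degree[of A b] by simp
  qed
  show "tensor_assoc (tensor_map form_cop id (form_cop a)) = tensor_map id form_cop (form_cop a)"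
    by (rule form_coassoc)
  show "lin (\<lambda>(b, c). scale (form_counit (basis_vec b)) (basis_vec c)) (form_cop a) = a"
    by (rule form_counit_left)
  show "lin (\<lambda>(b, c). scale (form_counit (basis_vec c)) (basis_vec b)) (form_cop a) = a"
    by (rule form_counit_right)
  show "form_cop (a \<bullet>\<^bsub>A\<^esub> b) = super_tensor_mult form_degree (twisted_mult A) (form_cop a) (form_cop b)"
    unfolding super_tensor_mult_eq by (rule form_cop_twisted_mult)
  show "form_cop one_form = one_form \<otimes> one_form" by simp
  show "form_counit (a \<bullet>\<^bsub>A\<^esub> b) = form_counit a * form_counit b"
    by (rule form_counit_twisted_mult)
  show "form_counit one_form = 1" by (simp add: one_form_def)
  show "lin (\<lambda>(b, c). twisted_antipode A (basis_vec b) \<bullet>\<^bsub>A\<^esub> basis_vec c) (form_cop a)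
      = scale (form_counit a) one_form"
    using conv_lin[of A "antipode_basis A" basis_vec a]
    by (simp add: twisted_antipode_def antipode_basis_left conv_unit_lin)
  show "lin (\<lambda>(b, c). basis_vec b \<bullet>\<^bsub>A\<^esub> twisted_antipode A (basis_vec c)) (form_cop a)
      = scale (form_counit a) one_form"
    using conv_lin[of A basis_vec "antipode_basis A" a]
    by (simp add: twisted_antipode_def antipode_basis_right conv_unit_lin)
qed

section \<open>The right-invariant forms\<close>

text \<open>
  The forms \<open>\<xi> = g\<^sup>-\<^sup>1 dg\<close> and \<open>\<eta> = g\<^sup>-\<^sup>1 dp\<close>, with classical products.
\<close>

abbreviation form_xi :: form where "form_xi \<equiv> mono_form 0 (-1) False True"

abbreviation form_eta :: form where "form_eta \<equiv> mono_form 0 (-1) True False"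

lemma twisted_mult_xi: "a \<bullet>\<^bsub>A\<^esub> form_xi = a \<curlywedge> form_xi"
  by (simp add: twisted_mult_basis)

lemma twisted_mult_eta: "a \<bullet>\<^bsub>A\<^esub> form_eta = step_left (\<i> * A) a \<curlywedge> form_eta"
  by (simp add: twisted_mult_basis twist_op_def shift_right.flow_0 shift_left.flow_1)

lemma form_cop_xi: "form_cop form_xi = form_xi \<otimes> one_form + one_form \<otimes> form_xi"
proof -
  have "form_xi = g_pow (- 1) \<curlywedge> gen_dg" by (simp add: wedge_mono)
  then have "form_cop form_xi = cop_g_pow (- 1) \<curlywedge>\<^sub>2 cop_dg"
    by (simp only: form_cop_wedge form_cop_values)
  then show ?thesis
    by (simp add: cop_g_pow_eq gen_g_def one_form_def tensor_mult_basis wedge_mono)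
qed

lemma form_cop_eta:
  "form_cop form_eta = gen_ginv \<otimes> form_eta + mono_form 1 (-1) False False \<otimes> form_xi + form_eta \<otimes> one_form"
proof -
  have "form_eta = g_pow (- 1) \<curlywedge> gen_dp" by (simp add: wedge_mono)
  then have "form_cop form_eta = cop_g_pow (- 1) \<curlywedge>\<^sub>2 cop_dp"
    by (simp only: form_cop_wedge form_cop_values)
  then show ?thesis
    by (simp add: cop_g_pow_eq gen_g_def gen_p_def gen_ginv_def one_form_def tensor_mult_basis wedge_mono algebra_simps)
qed

lemma form_cop_p_ginv: "form_cop (mono_form 1 (-1) False False)
    = mono_form 1 (-1) False False \<otimes> one_form + gen_ginv \<otimes> mono_form 1 (-1) False False"
proof -
  have "mono_form 1 (-1) False False = gen_p \<curlywedge> g_pow (- 1)" by (simp add: gen_p_def wedge_mono)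
  then have "form_cop (mono_form 1 (-1) False False) = cop_p \<curlywedge>\<^sub>2 cop_g_pow (- 1)"
    by (simp only: form_cop_wedge form_cop_values)
  then show ?thesis
    by (simp add: cop_p_eq cop_g_pow_eq gen_ginv_def one_form_def tensor_mult_basis wedge_mono)
qed

lemma ginv_times_p: "gen_ginv \<bullet>\<^bsub>A\<^esub> gen_p = mono_form 1 (-1) False False"
  by (simp add: gen_p_def gen_ginv_def twisted_mult_basis twist_op_def shift_left_fixed
      shift_right_fixed lie_left_mono lie_right_mono wedge_mono)

subsection \<open>A basis of the one-forms over degree zero\<close>

text \<open>
  Coordinates of a 1-form in the classical basis \<open>\<xi>\<close>, \<open>\<eta>\<close>; the exponent \<open>r + 1\<close> compensates the factor
  \<open>g\<^sup>-\<^sup>1\<close> of the basis forms.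
\<close>

definition coef_xi :: "form \<Rightarrow> form" where
  "coef_xi = lin (\<lambda>(n, r, i, j). if \<not> i \<and> j then mono_form n (r + 1) False False else 0)"

definition coef_eta :: "form \<Rightarrow> form" where
  "coef_eta = lin (\<lambda>(n, r, i, j). if i \<and> \<not> j then mono_form n (r + 1) False False else 0)"

lemma coef_linear [simp]:
  "coef_xi (u + v) = coef_xi u + coef_xi v" "coef_xi (scale c u) = scale c (coef_xi u)" "coef_xi 0 = 0"
  "coef_eta (u + v) = coef_eta u + coef_eta v" "coef_eta (scale c u) = scale c (coef_eta u)" "coef_eta 0 = 0"
  by (simp_all add: coef_xi_def coef_eta_def)

lemma coef_degree: "coef_xi v \<in> forms 0" "coef_eta v \<in> forms 0"
  unfolding coef_xi_def coef_eta_def by (rule homogeneous_lin; force)+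

lemma forms_1_decomposition:
  assumes "\<omega> \<in> forms 1"
  shows "\<omega> = coef_xi \<omega> \<curlywedge> form_xi + coef_eta \<omega> \<curlywedge> form_eta"
proof (rule linear_map_eq_on[where f = "\<lambda>v. v" and h = "\<lambda>v. coef_xi v \<curlywedge> form_xi + coef_eta v \<curlywedge> form_eta"])
  show "linear_map (\<lambda>v. coef_xi v \<curlywedge> form_xi + coef_eta v \<curlywedge> form_eta)"
    by (rule linear_mapI) (simp_all add: cvec.scale_right_distrib algebra_simps)
  fix b assume "b \<in> Poly_Mapping.keys \<omega>"
  with assms have deg: "form_degree b = 1" by (simp add: homogeneous_def)
  obtain n r i j where b: "b = (n, r, i, j)" by (cases b)
  show "basis_vec b = coef_xi (basis_vec b) \<curlywedge> form_xi + coef_eta (basis_vec b) \<curlywedge> form_eta"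
    using deg unfolding b by (cases i; cases j) (simp_all add: coef_xi_def coef_eta_def wedge_mono)
qed (rule linear_id)

lemma coef_wedge:
  assumes "a \<in> forms 0"
  shows "coef_xi (a \<curlywedge> form_xi) = a" "coef_xi (a \<curlywedge> form_eta) = 0"
    "coef_eta (a \<curlywedge> form_xi) = 0" "coef_eta (a \<curlywedge> form_eta) = a"
  using assms
proof (induction a rule: homogeneous_induct)
  case (basis b)
  {
    obtain n r i j where b: "b = (n, r, i, j)" by (cases b)
    case 1 show ?case using basis unfolding b by (simp add: coef_xi_def wedge_mono split: if_splits)
    case 2 show ?case using basis unfolding b by (simp add: coef_xi_def wedge_mono split: if_splits)
    case 3 show ?case using basis unfolding b by (simp add: coef_eta_def wedge_mono split: if_splits)
    case 4 show ?case using basis unfolding b by (simp add: coef_eta_def wedge_mono split: if_splits)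
  }
qed simp_all

lemma xi_eta_basis:
  assumes "\<omega> \<in> forms 1"
  shows "\<exists>!c. fst c \<in> forms 0 \<and> snd c \<in> forms 0 \<and> \<omega> = fst c \<bullet>\<^bsub>A\<^esub> form_xi + snd c \<bullet>\<^bsub>A\<^esub> form_eta"
proof (rule ex1I)
  let ?t = "\<i> * A"
  let ?c = "(coef_xi \<omega>, shift_left ?t (-1) (coef_eta \<omega>))"
  have "step_left ?t (shift_left ?t (-1) v) = v" for v
    using step_shift_left[of ?t "-1" v] by (simp add: shift_left.flow_0)
  then show "fst ?c \<in> forms 0 \<and> snd ?c \<in> forms 0 \<and> \<omega> = fst ?c \<bullet>\<^bsub>A\<^esub> form_xi + snd ?c \<bullet>\<^bsub>A\<^esub> form_eta"
    using forms_1_decomposition[OF assms] coef_degree shift_left_degree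
    by (simp add: twisted_mult_xi twisted_mult_eta)
  fix c :: "form \<times> form"
  assume "fst c \<in> forms 0 \<and> snd c \<in> forms 0 \<and> \<omega> = fst c \<bullet>\<^bsub>A\<^esub> form_xi + snd c \<bullet>\<^bsub>A\<^esub> form_eta"
  then have c: "fst c \<in> forms 0" "snd c \<in> forms 0"
    and \<omega>: "\<omega> = fst c \<curlywedge> form_xi + step_left ?t (snd c) \<curlywedge> form_eta"
    by (simp_all add: twisted_mult_xi twisted_mult_eta)
  have "step_left ?t (snd c) \<in> forms 0"
    using c by (simp add: step_left_def lie_left_degree)
  with c have "coef_xi \<omega> = fst c" "coef_eta \<omega> = step_left ?t (snd c)"
    by (simp_all add: \<omega> coef_wedge)
  moreover have "shift_left ?t (-1) (step_left ?t (snd c)) = snd c"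
    using shift_left_step[of ?t "-1" "snd c"] by (simp add: shift_left.flow_0)
  ultimately show "c = ?c" by (simp add: prod_eq_iff)
qed

subsection \<open>Right-invariant one-forms\<close>

lemma basis_vec_eq_iff: "basis_vec b = basis_vec c \<longleftrightarrow> b = c"
  by (metis lookup_single_eq lookup_single_not_eq one_neq_zero)

lemma xi_eta_independent: "form_xi \<noteq> form_eta" "cvec.independent {form_xi, form_eta}"
proof -
  have "form_eta \<noteq> 0" by (metis lookup_single_eq lookup_zero one_neq_zero)
  have "form_xi \<noteq> scale k form_eta" for k
  proof
    assume "form_xi = scale k form_eta"
    then have "Poly_Mapping.lookup form_xi (0, -1, False, True)
        = Poly_Mapping.lookup (scale k form_eta) (0, -1, False, True)" by simp
    then show False by (simp add: lookup_single)
  qed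
  with \<open>form_eta \<noteq> 0\<close> show "form_xi \<noteq> form_eta" "cvec.independent {form_xi, form_eta}"
    by (auto simp: basis_vec_eq_iff cvec.independent_insert cvec.span_singleton)
qed

lemma xi_right_invariant: "right_invariant form_xi"
  and eta_right_invariant: "right_invariant form_eta"
  by (simp_all add: right_invariant_def coact_right_def form_cop_xi form_cop_eta gen_ginv_def one_form_def)

lemma lin_coact_right:
  assumes "\<And>b. form_degree b \<noteq> 0 \<Longrightarrow> f b = 0"
  shows "lin (\<lambda>(u, b). scale (f b) (basis_vec u)) (coact_right \<omega>)
    = lin (\<lambda>(u, b). scale (f b) (basis_vec u)) (form_cop \<omega>)"
  unfolding coact_right_def lin_tensor_map
  by (rule lin_cong_keys) (auto simp: assms)

text \<open>
  Contracting the second leg of the coproduct of a right-invariant form with a functional that takes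
  the value 1 at 1 returns the form.
\<close>

lemma right_invariant_lin:
  assumes "\<And>b. form_degree b \<noteq> 0 \<Longrightarrow> f b = 0" "right_invariant \<omega>" "f (0, 0, False, False) = 1"
  shows "lin (\<lambda>(u, b). scale (f b) (basis_vec u)) (form_cop \<omega>) = \<omega>"
proof -
  have "lin (\<lambda>(u, b). scale (f b) (basis_vec u)) (\<omega> \<otimes> one_form) = \<omega>"
    unfolding lin_tensor by (simp add: one_form_def assms(3))
  then show ?thesis
    using lin_coact_right[of f \<omega>] assms by (simp add: right_invariant_def)
qed

lemma lookup_lie_right:
  "Poly_Mapping.lookup (lie_right a) (n, r, i, j) = of_nat (Suc n) * Poly_Mapping.lookup a (Suc n, r, i, j)"
proof (induction a rule: cvec_induct)
  case (basis b)
  obtain m s k l where b: "b = (m, s, k, l)" by (cases b)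
  show ?case unfolding b lie_right_mono by (cases m) (auto simp: lookup_single when_def)
qed (simp_all add: lookup_add algebra_simps)

lemma lookup_lin_filter:
  "Poly_Mapping.lookup (lin (\<lambda>b. if Q b then basis_vec b else 0) a) k = (if Q k then Poly_Mapping.lookup a k else 0)"
  by (induction a rule: cvec_induct) (auto simp: lookup_add lookup_single when_def)

lemma right_invariant_one_forms:
  "cvec.span {form_xi, form_eta} = {\<omega> \<in> forms 1. right_invariant \<omega>}"
proof
  have [simp]: "coact_right (u + v) = coact_right u + coact_right v"
    "coact_right (scale c u) = scale c (coact_right u)" "coact_right 0 = 0" for u v c
    by (simp_all add: coact_right_def)
  have "cvec.subspace {\<omega> \<in> forms 1. right_invariant \<omega>}"
    by (rule cvec.subspaceI) (auto simp: right_invariant_def)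
  then show "cvec.span {form_xi, form_eta} \<subseteq> {\<omega> \<in> forms 1. right_invariant \<omega>}"
    by (intro cvec.span_minimal) (auto simp: xi_right_invariant eta_right_invariant)
  show "{\<omega> \<in> forms 1. right_invariant \<omega>} \<subseteq> cvec.span {form_xi, form_eta}"
  proof clarify
    fix \<omega> assume deg: "\<omega> \<in> forms 1" and inv: "right_invariant \<omega>"
    \<comment> \<open>with \<open>t = c = 1\<close> this is \<open>Y \<omega> = \<omega>\<close>, whence \<open>E\<^sub>R \<omega> = 0\<close>\<close>
    have "shift_right 1 1 \<omega> = \<omega>"
      unfolding shift_right_def
      by (rule right_invariant_lin[OF _ inv]) (auto simp: chi_degree, simp add: chi_def)
    then have lie: "lie_right \<omega> = 0"
      by (simp add: shift_right.flow_1 step_right_def)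
    \<comment> \<open>contraction with the functional \<open>g\<^sup>s \<mapsto> \<delta>\<^sub>s\<^sub>0\<close> projects onto right weight 0\<close>
    have "lin (\<lambda>(u, b). scale (if wt_right b = 0 then form_counit (basis_vec b) else 0) (basis_vec u))
       (form_cop v) = lin (\<lambda>b. if wt_right b = 0 then basis_vec b else 0) v" for v
    proof (induction v rule: cvec_induct)
      case (basis a)
      have "lin (\<lambda>(u, b). scale (if wt_right b = 0 then form_counit (basis_vec b) else 0) (basis_vec u))
          (form_cop (basis_vec a))
        = lin (\<lambda>(u, b). scale (of_bool (wt_right a = 0)) (scale (form_counit (basis_vec b)) (basis_vec u)))
          (form_cop (basis_vec a))"
        by (rule lin_cong_keys) (auto dest!: form_cop_keyD(3))
      also have "\<dots> = scale (of_bool (wt_right a = 0))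
          (lin (\<lambda>(u, b). scale (form_counit (basis_vec b)) (basis_vec u)) (form_cop (basis_vec a)))"
        unfolding lin_scale_fun[symmetric] by (simp add: case_prod_unfold)
      finally show ?case by (simp add: form_counit_right)
    qed simp_all
    moreover have "lin (\<lambda>(u, b). scale (if wt_right b = 0 then form_counit (basis_vec b) else 0) (basis_vec u))
        (form_cop \<omega>) = \<omega>"
      by (rule right_invariant_lin[OF _ inv]) (auto simp: form_counit_degree)
    ultimately have "lin (\<lambda>b. if wt_right b = 0 then basis_vec b else 0) \<omega> = \<omega>"
      by simp
    then have wt: "wt_right b = 0" if "b \<in> Poly_Mapping.keys \<omega>" for b
      using that lookup_lin_filter[of "\<lambda>b. wt_right b = 0" \<omega> b] by (auto simp: in_keys_iff split: if_splits)
    have "Poly_Mapping.keys \<omega> \<subseteq> {(0, -1, False, True), (0, -1, True, False)}"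
    proof
      fix b assume b: "b \<in> Poly_Mapping.keys \<omega>"
      obtain n r i j where eq: "b = (n, r, i, j)" by (cases b)
      have "n = 0"
        using b lookup_lie_right[of \<omega> "n - 1" r i j] by (cases n) (auto simp: eq lie in_keys_iff simp del: of_nat_Suc)
      moreover have "form_degree b = 1" using deg b by (simp add: homogeneous_def)
      ultimately show "b \<in> {(0, -1, False, True), (0, -1, True, False)}"
        using wt[OF b] by (cases i; cases j) (auto simp: eq)
    qed
    then show "\<omega> \<in> cvec.span {form_xi, form_eta}"
      by (induction \<omega> rule: supported_induct)
        (auto intro: cvec.span_base cvec.span_add cvec.span_scale cvec.span_zero)
  qed
qed

subsection \<open>Commutators and antipode\<close>

lemma lie_xi [simp]: "lie_left form_xi = 0" "lie_right form_xi = 0"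
  and lie_eta [simp]: "lie_left form_eta = form_xi" "lie_right form_eta = 0"
  by (simp_all add: lie_left_mono lie_right_mono)

lemma shift_left_eta: "shift_left t c form_eta = form_eta + scale (t * of_int c) form_xi"
proof (induction c rule: int_induct[of _ 0])
  case (step1 i)
  have "shift_left t (i + 1) form_eta = step_left t (form_eta + scale (t * of_int i) form_xi)"
    by (simp only: step_shift_left[symmetric] step1)
  also have "\<dots> = form_eta + scale (t * of_int (i + 1)) form_xi"
    by (simp add: step_left_def cvec.scale_left_distrib algebra_simps)
  finally show ?case .
next
  case (step2 i)
  have "step_left t (shift_left t (i - 1) form_eta) = form_eta + scale (t * of_int i) form_xi"
    using step2 by (simp add: shift_left.flow_back)
  also have "\<dots> = step_left t (form_eta + scale (t * of_int (i - 1)) form_xi)"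
    by (simp add: step_left_def cvec.scale_left_distrib cvec.scale_left_diff_distrib
        linear_map_diff[OF linear_lie_left] algebra_simps)
  finally show ?case by (simp only: shift_left.step_cancel)
qed (simp add: shift_left.flow_0)

lemma commutator_xi:
  assumes "a \<in> forms 0"
  shows "twisted_commutator A a form_xi = 0"
  using assms
proof (induction a rule: homogeneous_induct)
  case (basis b)
  obtain n r i j where b: "b = (n, r, i, j)" by (cases b)
  show ?case
    using basis unfolding b twisted_commutator_def twisted_mult_xi twisted_mult_basis
    by (simp add: twist_op_def shift_left_fixed shift_right_fixed shift_left.flow_0 shift_right.flow_0
        wedge_mono split: if_splits)
qed (simp_all add: twisted_commutator_def algebra_simps cvec.scale_right_diff_distrib[symmetric])

lemma commutator_eta:
  assumes "a \<in> forms 0"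
  shows "twisted_commutator A a form_eta = scale (\<i> * A) (ext_d a)"
  using assms
proof (induction a rule: homogeneous_induct)
  case (basis b)
  obtain n r i j where b: "b = (n, r, i, j)" by (cases b)
  with basis have ij: "\<not> i" "\<not> j" by (auto split: if_splits)
  have "mono_form n r False False \<bullet>\<^bsub>A\<^esub> form_eta
      = mono_form n (r - 1) True False + scale (\<i> * A * of_nat n) (mono_form (n - 1) r True False)"
    by (simp add: twisted_mult_eta step_left_def lie_left_mono wedge_mono)
  moreover have "form_eta \<bullet>\<^bsub>A\<^esub> mono_form n r False False
      = mono_form n (r - 1) True False - scale (\<i> * A * of_int r) (mono_form n (r - 1) False True)"
    by (simp add: twisted_mult_basis twist_op_def shift_right_fixed shift_left_eta wedge_mono cvec.scale_minus_left)
  ultimately show ?case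
    unfolding b using ij by (simp add: twisted_commutator_def ext_d_mono cvec.scale_right_distrib mult.assoc)
next
  case (add u v)
  then show ?case by (simp add: twisted_commutator_def algebra_simps cvec.scale_right_distrib)
next
  case (scale c u)
  then show ?case
    by (simp add: twisted_commutator_def cvec.scale_right_diff_distrib[symmetric] mult.commute)
qed (simp add: twisted_commutator_def)

lemma twisted_mult_g_0 [simp]: "g_pow 0 \<bullet>\<^bsub>A\<^esub> a = a" "a \<bullet>\<^bsub>A\<^esub> g_pow 0 = a"
  by (simp_all add: one_form_def[symmetric])

lemma antipode_xi: "twisted_antipode A form_xi = - form_xi"
proof -
  have "conv A (antipode_basis A) basis_vec (0, -1, False, True) = conv_unit (0, -1, False, True)"
    by (simp add: antipode_basis_left)
  then show ?thesis
    by (simp add: conv_def form_cop_xi one_form_def antipode_basis_g conv_unit_def twisted_antipode_def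
        eq_neg_iff_add_eq_0)
qed

lemma antipode_eta:
  "twisted_antipode A form_eta = - (gen_g \<bullet>\<^bsub>A\<^esub> form_eta) + gen_p \<bullet>\<^bsub>A\<^esub> form_xi"
proof -
  \<comment> \<open>the coproduct of \<open>\<eta>\<close> involves \<open>p g\<^sup>-\<^sup>1\<close>, whose antipode \<open>-p\<close> is found first\<close>
  have "conv A (antipode_basis A) basis_vec (1, -1, False, False) = conv_unit (1, -1, False, False)"
    by (simp add: antipode_basis_left)
  then have "antipode_basis A (1, -1, False, False) + gen_g \<bullet>\<^bsub>A\<^esub> mono_form 1 (-1) False False = 0"
    by (simp add: conv_def form_cop_p_ginv[simplified] gen_ginv_def gen_g_def one_form_def antipode_basis_g conv_unit_def)
  moreover have "gen_g \<bullet>\<^bsub>A\<^esub> mono_form 1 (-1) False False = gen_p"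
    by (simp add: gen_g_def gen_p_def twisted_mult_basis twist_op_def shift_right.flow_0 shift_left_fixed
        lie_left_mono wedge_mono)
  ultimately have p: "antipode_basis A (1, -1, False, False) = - gen_p"
    by (simp add: eq_neg_iff_add_eq_0)
  have "conv A (antipode_basis A) basis_vec (0, -1, True, False) = conv_unit (0, -1, True, False)"
    by (simp add: antipode_basis_left)
  then have "gen_g \<bullet>\<^bsub>A\<^esub> form_eta - gen_p \<bullet>\<^bsub>A\<^esub> form_xi + antipode_basis A (0, -1, True, False) = 0"
    by (simp add: conv_def form_cop_eta gen_ginv_def one_form_def antipode_basis_g conv_unit_def p[simplified]
        gen_g_def)
  then show ?thesis
    by (simp add: twisted_antipode_def algebra_simps eq_neg_iff_add_eq_0)
qed

theorem proposition4p4: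
  fixes hbar G A :: complex
  assumes "G \<noteq> 0" and "A = hbar / G"
  shows "exterior_algebra form_degree (twisted_mult A) one_form ext_d \<and>
    (\<exists>\<xi> \<eta>.
      \<xi> \<in> forms 1 \<and> \<eta> \<in> forms 1 \<and> right_invariant \<xi> \<and> right_invariant \<eta> \<and>
      (\<forall>\<omega>\<in>forms 1. \<exists>!c. fst c \<in> forms 0 \<and> snd c \<in> forms 0 \<and>
         \<omega> = fst c \<bullet>\<^bsub>A\<^esub> \<xi> + snd c \<bullet>\<^bsub>A\<^esub> \<eta>) \<and>
      \<xi> \<noteq> \<eta> \<and> cvec.independent {\<xi>, \<eta>} \<and>
      cvec.span {\<xi>, \<eta>} = {\<omega> \<in> forms 1. right_invariant \<omega>} \<and>
      ext_d gen_g = gen_g \<bullet>\<^bsub>A\<^esub> \<xi> \<and>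
      ext_d gen_p = gen_g \<bullet>\<^bsub>A\<^esub> \<eta> \<and>
      (\<forall>a\<in>forms 0. twisted_commutator A a \<xi> = 0) \<and>
      (\<forall>a\<in>forms 0. twisted_commutator A a \<eta> = scale (\<i> * A) (ext_d a)) \<and>
      coact_left \<xi> = one_form \<otimes> \<xi> \<and>
      coact_left \<eta> = gen_ginv \<otimes> \<eta> + (gen_ginv \<bullet>\<^bsub>A\<^esub> gen_p) \<otimes> \<xi> \<and>
      \<xi> \<bullet>\<^bsub>A\<^esub> \<xi> = 0 \<and>
      \<eta> \<bullet>\<^bsub>A\<^esub> \<xi> = - (\<xi> \<bullet>\<^bsub>A\<^esub> \<eta>) \<and>
      \<eta> \<bullet>\<^bsub>A\<^esub> \<eta> = scale (\<i> * A) (\<xi> \<bullet>\<^bsub>A\<^esub> \<eta>) \<and>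
      ext_d \<xi> = 0 \<and>
      ext_d \<eta> = \<eta> \<bullet>\<^bsub>A\<^esub> \<xi> \<and>
      (\<exists>S. super_hopf_algebra form_degree (twisted_mult A) one_form form_cop form_counit S \<and>
         form_cop \<xi> = \<xi> \<otimes> one_form + one_form \<otimes> \<xi> \<and>
         form_cop \<eta> = gen_ginv \<otimes> \<eta> + (gen_ginv \<bullet>\<^bsub>A\<^esub> gen_p) \<otimes> \<xi> + \<eta> \<otimes> one_form \<and>
         form_counit \<xi> = 0 \<and> form_counit \<eta> = 0 \<and>
         S \<xi> = - \<xi> \<and>
         S \<eta> = - (gen_g \<bullet>\<^bsub>A\<^esub> \<eta>) + gen_p \<bullet>\<^bsub>A\<^esub> \<xi>))"
proof (rule conjI[OF twisted_exterior_algebra], rule exI[of _ form_xi], rule exI[of _ form_eta],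
    intro conjI ballI exI[of _ "twisted_antipode A"])
  show "super_hopf_algebra form_degree (twisted_mult A) one_form form_cop form_counit (twisted_antipode A)"
    by (rule twisted_super_hopf_algebra)
  fix \<omega> assume "\<omega> \<in> forms 1"
  then show "\<exists>!c. fst c \<in> forms 0 \<and> snd c \<in> forms 0 \<and>
      \<omega> = fst c \<bullet>\<^bsub>A\<^esub> form_xi + snd c \<bullet>\<^bsub>A\<^esub> form_eta"
    by (rule xi_eta_basis)
next
  show "cvec.span {form_xi, form_eta} = {\<omega> \<in> forms 1. right_invariant \<omega>}"
    by (rule right_invariant_one_forms)
  fix a assume "a \<in> forms 0"
  then show "twisted_commutator A a form_xi = 0"
    "twisted_commutator A a form_eta = scale (\<i> * A) (ext_d a)"
    by (rule commutator_xi commutator_eta)+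
next
  show "coact_left form_xi = one_form \<otimes> form_xi"
    by (simp add: coact_left_def form_cop_xi one_form_def)
  show "coact_left form_eta = gen_ginv \<otimes> form_eta + (gen_ginv \<bullet>\<^bsub>A\<^esub> gen_p) \<otimes> form_xi"
    unfolding ginv_times_p by (simp add: coact_left_def form_cop_eta gen_ginv_def one_form_def)
  show "form_eta \<bullet>\<^bsub>A\<^esub> form_eta = scale (\<i> * A) (form_xi \<bullet>\<^bsub>A\<^esub> form_eta)"
    "form_eta \<bullet>\<^bsub>A\<^esub> form_xi = - (form_xi \<bullet>\<^bsub>A\<^esub> form_eta)"
    by (simp_all add: twisted_mult_xi twisted_mult_eta step_left_def wedge_mono)
  show "ext_d form_eta = form_eta \<bullet>\<^bsub>A\<^esub> form_xi"
    by (simp add: twisted_mult_xi ext_d_mono wedge_mono)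
  show "ext_d gen_g = gen_g \<bullet>\<^bsub>A\<^esub> form_xi" "ext_d gen_p = gen_g \<bullet>\<^bsub>A\<^esub> form_eta"
    by (simp_all add: twisted_mult_xi twisted_mult_eta step_left_def lie_left_mono gen_g_def gen_p_def ext_d_mono wedge_mono)
  show "form_xi \<bullet>\<^bsub>A\<^esub> form_xi = 0"
    by (simp add: twisted_mult_xi wedge_mono)
  show "form_cop form_xi = form_xi \<otimes> one_form + one_form \<otimes> form_xi"
    by (rule form_cop_xi)
  show "form_cop form_eta = gen_ginv \<otimes> form_eta + (gen_ginv \<bullet>\<^bsub>A\<^esub> gen_p) \<otimes> form_xi + form_eta \<otimes> one_form"
    by (simp only: form_cop_eta ginv_times_p)
  show "twisted_antipode A form_xi = - form_xi"
    "twisted_antipode A form_eta = - (gen_g \<bullet>\<^bsub>A\<^esub> form_eta) + gen_p \<bullet>\<^bsub>A\<^esub> form_xi"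
    by (rule antipode_xi antipode_eta)+
qed (simp_all only: xi_eta_independent xi_right_invariant eta_right_invariant not_False_eq_True,
  simp_all add: ext_d_mono)

end
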